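(* Let $(H,A,C)$ be a Doi Hom-Hopf datum, with underlying objects $(H,\alpha)$, $(A,\beta)$, $(C,\gamma)$, and let $(M,\mu),(N,\nu)\in\widetilde{\mathscr{H}}(\mathscr{M}_k)(H)^{C}_{A}$. Suppose that there exists a normalized $(A,\beta)$-integral $\theta:(C,\gamma)\otimes(C,\gamma)\rightarrow(A,\beta)$. Then a monomorphism (resp. epimorphism) $f:(M,\mu)\rightarrow(N,\nu)$ in $\widetilde{\mathscr{H}}(\mathscr{M}_k)(H)^{C}_{A}$ splits in $\widetilde{\mathscr{H}}(\mathscr{M}_k)(H)^{C}_{A}$ if the monomorphism (resp. epimorphism) $f$ splits as a morphism of right $(A,\beta)$-Hom-modules, i.e. in $\widetilde{\mathscr{H}}(\mathscr{M}_k)_{A}$.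
   Context: Let $k$ be a commutative ring, $\mathscr{M}_k$ the category of $k$-modules, $\otimes=\otimes_k$. The category $\widetilde{\mathscr{H}}(\mathscr{M}_k)$ has as objects pairs $(M,\mu)$ with $M$ a $k$-module and $\mu$ a $k$-linear automorphism of $M$; a morphism $f:(M,\mu)\to(N,\nu)$ is a $k$-linear map with $\nu f=f\mu$. Put $(M,\mu)\otimes(N,\nu)=(M\otimes N,\mu\otimes\nu)$. Sumless Sweedler notation is used. A monomorphism splits in a category if it has a left inverse there; an epimorphism splits if it has a right inverse there. A monoidal Hom-algebra is an object $(A,\beta)$ with a $k$-linear multiplication $A\otimes A\to A$ and $1_A\in A$ such that $\beta(ab)=\beta(a)\beta(b)$, $\beta(1_A)=1_A$, $\beta(a)(bc)=(ab)\beta(c)$, $a1_A=1_Aa=\beta(a)$. A monoidal Hom-coalgebra is an object $(C,\gamma)$ with $k$-linear maps $\Delta:C\to C\otimes C$, $\Delta(c)=c_{(1)}\otimes c_{(2)}$, and $\varepsilon:C\to k$ such that $\Delta(\gamma(c))=\gamma(c_{(1)})\otimes\gamma(c_{(2)})$, $\varepsilon(\gamma(c))=\varepsilon(c)$, $\gamma^{-1}(c_{(1)})\otimes c_{(2)(1)}\otimes c_{(2)(2)}=c_{(1)(1)}\otimes c_{(1)(2)}\otimes\gamma^{-1}(c_{(2)})$, $\varepsilon(c_{(1)})c_{(2)}=\varepsilon(c_{(2)})c_{(1)}=\gamma^{-1}(c)$. A monoidal Hom-bialgebra $(H,\alpha)$ is both a monoidal Hom-algebra and a monoidal Hom-coalgebra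 (with the same $\alpha$) with $\Delta(ab)=a_{(1)}b_{(1)}\otimes a_{(2)}b_{(2)}$, $\Delta(1_H)=1_H\otimes1_H$, $\varepsilon(ab)=\varepsilon(a)\varepsilon(b)$, $\varepsilon(1_H)=1$. It is a monoidal Hom-Hopf algebra if there is a $k$-linear $S:H\to H$ with $S\alpha=\alpha S$ and $S(h_{(1)})h_{(2)}=h_{(1)}S(h_{(2)})=\varepsilon(h)1_H$. A right $(A,\beta)$-Hom-module is an object $(M,\mu)$ with a $k$-linear map $M\otimes A\to M$, $m\otimes a\mapsto m\cdot a$, such that $\mu(m\cdot a)=\mu(m)\cdot\beta(a)$, $(m\cdot a)\cdot\beta(b)=\mu(m)\cdot(ab)$, $m\cdot1_A=\mu(m)$. Together with the $A$-linear morphisms of $\widetilde{\mathscr{H}}(\mathscr{M}_k)$ these form the category $\widetilde{\mathscr{H}}(\mathscr{M}_k)_A$. A right $(C,\gamma)$-Hom-comodule is an object $(M,\mu)$ with a $k$-linear map $\rho_M:M\to M\otimes C$, $\rho_M(m)=m_{[0]}\otimes m_{[1]}$, such that $\rho_M(\mu(m))=\mu(m_{[0]})\otimes\gamma(m_{[1]})$, $m_{[0][0]}\otimes m_{[0][1]}\otimes\gamma^{-1}(m_{[1]})=\mu^{-1}(m_{[0]})\otimes\Delta(m_{[1]})$, $m_{[0]}\varepsilon(m_{[1]})=\mu^{-1}(m)$. Morphisms are the colinear morphisms of $\widetilde{\mathscr{H}}(\mathscr{M}_k)$. A right $(H,\alpha)$-Hom-comodule algebra is a monoidal Hom-algebra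 $(A,\beta)$ that is a right $(H,\alpha)$-Hom-comodule via $\rho_A(a)=a_{[0]}\otimes a_{[1]}\in A\otimes H$ with $\rho_A(ab)=a_{[0]}b_{[0]}\otimes a_{[1]}b_{[1]}$ and $\rho_A(1_A)=1_A\otimes1_H$. A right $(H,\alpha)$-Hom-module coalgebra is a monoidal Hom-coalgebra $(C,\gamma)$ that is a right $(H,\alpha)$-Hom-module with $\Delta(c\cdot h)=c_{(1)}\cdot h_{(1)}\otimes c_{(2)}\cdot h_{(2)}$ and $\varepsilon(c\cdot h)=\varepsilon(c)\varepsilon(h)$. A Doi Hom-Hopf datum $(H,A,C)$ consists of a monoidal Hom-Hopf algebra $(H,\alpha)$, a right $(H,\alpha)$-Hom-comodule algebra $(A,\beta)$ and a right $(H,\alpha)$-Hom-module coalgebra $(C,\gamma)$. A Doi Hom-Hopf module is an object $(M,\mu)$ that is both a right $(A,\beta)$-Hom-module and a right $(C,\gamma)$-Hom-comodule such that $\rho_M(m\cdot a)=m_{[0]}\cdot a_{[0]}\otimes m_{[1]}\cdot a_{[1]}$ for all $m\in M$, $a\in A$. With maps that are both $A$-linear and $C$-colinear morphisms, they form the category $\widetilde{\mathscr{H}}(\mathscr{M}_k)(H)^{C}_{A}$. A normalized $(A,\beta)$-integral is a $k$-linear map $\theta:C\otimes C\to A$ with $\theta\circ(\gamma\otimes\gamma)=\beta\circ\theta$ such that for all $a\in A$, $c,d\in C$: (i) $\theta(\gamma^{-1}(d)\otimes c_{(1)})\otimes\gamma(c_{(2)})=\beta\big(\theta(d_{(2)}\otimes\gamma^{-1}(c))_{[0]}\big)\otimes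 d_{(1)}\cdot\theta(d_{(2)}\otimes\gamma^{-1}(c))_{[1]}$ in $A\otimes C$; (ii) $\theta(c_{(1)}\otimes c_{(2)})=1_A\varepsilon(c)$; (iii) $\beta^2(a_{[0][0]})\,\theta\big(\gamma^{-1}(d)\cdot a_{[0][1]}\otimes\gamma^{-1}(c)\cdot\alpha^{-1}(a_{[1]})\big)=\theta(d\otimes c)\,a$. *)

theory Defs
  imports "HOL-Algebra.Module"
begin

definition linear_map ::
  "('k, 'x) ring_scheme \<Rightarrow> ('k, 'm, 'y) module_scheme \<Rightarrow> ('k, 'n, 'z) module_scheme
    \<Rightarrow> ('m \<Rightarrow> 'n) \<Rightarrow> bool" where
  "linear_map k M N f \<longleftrightarrow>
     f \<in> carrier M \<rightarrow> carrier N \<and>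
     (\<forall>x\<in>carrier M. \<forall>y\<in>carrier M. f (x \<oplus>\<^bsub>M\<^esub> y) = f x \<oplus>\<^bsub>N\<^esub> f y) \<and>
     (\<forall>r\<in>carrier k. \<forall>x\<in>carrier M. f (r \<odot>\<^bsub>M\<^esub> x) = r \<odot>\<^bsub>N\<^esub> f x)"

definition regular_module :: "('k, 'x) ring_scheme \<Rightarrow> ('k, 'k) module" where
  "regular_module k =
     \<lparr>carrier = carrier k, mult = mult k, one = one k, zero = zero k, add = add k,
      smult = mult k\<rparr>"

text \<open>The tensor product is the set of formal finite sums of pairs, encoded as lists (append
  is addition), modulo the congruence generated by commutativity and bilinearity. Negatives need
  no generator of their own: the pair of \<open>- m\<close> and \<open>n\<close> is the negative of
  the pair of \<open>m\<close> and \<open>n\<close>.\<close>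

inductive tensor_cong ::
  "('k, 'x) ring_scheme \<Rightarrow> ('k, 'm, 'y) module_scheme \<Rightarrow> ('k, 'n, 'z) module_scheme
    \<Rightarrow> ('m \<times> 'n) list \<Rightarrow> ('m \<times> 'n) list \<Rightarrow> bool"
  for k M N where
  refl: "u \<in> lists (carrier M \<times> carrier N) \<Longrightarrow> tensor_cong k M N u u"
| sym: "tensor_cong k M N u v \<Longrightarrow> tensor_cong k M N v u"
| trans: "tensor_cong k M N u v \<Longrightarrow> tensor_cong k M N v w \<Longrightarrow> tensor_cong k M N u w"
| append: "tensor_cong k M N u u' \<Longrightarrow> tensor_cong k M N v v' \<Longrightarrow>
    tensor_cong k M N (u @ v) (u' @ v')"
| commute: "u \<in> lists (carrier M \<times> carrier N) \<Longrightarrow> v \<in> lists (carrier M \<times> carrier N) \<Longrightarrow>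
    tensor_cong k M N (u @ v) (v @ u)"
| zero_left: "n \<in> carrier N \<Longrightarrow> tensor_cong k M N [(\<zero>\<^bsub>M\<^esub>, n)] []"
| zero_right: "m \<in> carrier M \<Longrightarrow> tensor_cong k M N [(m, \<zero>\<^bsub>N\<^esub>)] []"
| add_left: "m \<in> carrier M \<Longrightarrow> m' \<in> carrier M \<Longrightarrow> n \<in> carrier N \<Longrightarrow>
    tensor_cong k M N [(m \<oplus>\<^bsub>M\<^esub> m', n)] [(m, n), (m', n)]"
| add_right: "m \<in> carrier M \<Longrightarrow> n \<in> carrier N \<Longrightarrow> n' \<in> carrier N \<Longrightarrow>
    tensor_cong k M N [(m, n \<oplus>\<^bsub>N\<^esub> n')] [(m, n), (m, n')]"
| smult: "r \<in> carrier k \<Longrightarrow> m \<in> carrier M \<Longrightarrow> n \<in> carrier N \<Longrightarrow>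
    tensor_cong k M N [(r \<odot>\<^bsub>M\<^esub> m, n)] [(m, r \<odot>\<^bsub>N\<^esub> n)]"

type_synonym ('m, 'n) tensor = "('m \<times> 'n) list set"

definition tensor_class ::
  "('k, 'x) ring_scheme \<Rightarrow> ('k, 'm, 'y) module_scheme \<Rightarrow> ('k, 'n, 'z) module_scheme
    \<Rightarrow> ('m \<times> 'n) list \<Rightarrow> ('m, 'n) tensor" where
  "tensor_class k M N u = {v. tensor_cong k M N u v}"

definition pure_tensor ::
  "'m \<Rightarrow> ('k, 'x) ring_scheme \<Rightarrow> ('k, 'm, 'y) module_scheme \<Rightarrow> ('k, 'n, 'z) module_scheme
    \<Rightarrow> 'n \<Rightarrow> ('m, 'n) tensor"
  (\<open>(_ \<boxtimes>\<^bsub>_,_,_\<^esub>/ _)\<close> [66, 0, 0, 0, 66] 65) where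
  "m \<boxtimes>\<^bsub>k,M,N\<^esub> n = tensor_class k M N [(m, n)]"

text \<open>The fields \<open>mult\<close> and \<open>one\<close> play no role for a module.\<close>

definition tensor ::
  "('k, 'x) ring_scheme \<Rightarrow> ('k, 'm, 'y) module_scheme \<Rightarrow> ('k, 'n, 'z) module_scheme
    \<Rightarrow> ('k, ('m, 'n) tensor) module" where
  "tensor k M N =
     \<lparr>carrier = tensor_class k M N ` lists (carrier M \<times> carrier N),
      mult = undefined,
      one = undefined,
      zero = tensor_class k M N [],
      add = (\<lambda>s t. \<Union>u\<in>s. \<Union>v\<in>t. tensor_class k M N (u @ v)),
      smult = (\<lambda>r t. \<Union>u\<in>t. tensor_class k M N (map (\<lambda>(m, n). (r \<odot>\<^bsub>M\<^esub> m, n)) u))\<rparr>"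

text \<open>Sweedler notation: if \<open>t\<close> is the sum of pure tensors of \<open>x\<^sub>i\<close> and \<open>y\<^sub>i\<close>, then
  \<open>sweedler P t F\<close> is the sum of the \<open>F x\<^sub>i y\<^sub>i\<close> in \<open>P\<close>. This does not depend on the chosen
  representation of \<open>t\<close> as long as \<open>F\<close> is \<open>k\<close>-bilinear on the carriers, which is the case in
  every use below.\<close>

definition sweedler ::
  "('k, 'p, 'x) module_scheme \<Rightarrow> ('m, 'n) tensor \<Rightarrow> ('m \<Rightarrow> 'n \<Rightarrow> 'p) \<Rightarrow> 'p" where
  "sweedler P t F =
     foldr (\<lambda>(x, y) s. F x y \<oplus>\<^bsub>P\<^esub> s) (SOME u. u \<in> t) \<zero>\<^bsub>P\<^esub>"

record ('k, 'm) hom_object = "('k, 'm) module" +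
  aut :: "'m \<Rightarrow> 'm"

locale hom_object = Module.module k M
  for k :: "('k, 'x) ring_scheme" and M :: "('k, 'm, 'y) hom_object_scheme" +
  assumes aut_linear: "linear_map k M M (aut M)"
    and aut_bij: "bij_betw (aut M) (carrier M) (carrier M)"

definition aut_inv :: "('k, 'm, 'y) hom_object_scheme \<Rightarrow> 'm \<Rightarrow> 'm" where
  "aut_inv M = inv_into (carrier M) (aut M)"

text \<open>Morphisms of Hom-objects; as everywhere in HOL-Algebra, only the values on the carrier
  matter.\<close>

definition hom_object_hom ::
  "('k, 'x) ring_scheme \<Rightarrow> ('k, 'm, 'y) hom_object_scheme \<Rightarrow> ('k, 'n, 'z) hom_object_scheme
    \<Rightarrow> ('m \<Rightarrow> 'n) \<Rightarrow> bool" where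
  "hom_object_hom k M N f \<longleftrightarrow>
     linear_map k M N f \<and> (\<forall>m\<in>carrier M. aut N (f m) = f (aut M m))"

text \<open>The structure maps are passed separately, since a Hom-bialgebra has to be used both as a
  Hom-algebra and as a Hom-coalgebra. The product of \<open>a\<close> and \<open>b\<close> is \<open>mul\<close> applied to their
  pure tensor.\<close>

locale hom_algebra = hom_object k A
  for k :: "('k, 'x) ring_scheme" and A :: "('k, 'a, 'y) hom_object_scheme"
    and mul :: "('a, 'a) tensor \<Rightarrow> 'a" and unit :: 'a +
  assumes mul_linear: "linear_map k (tensor k A A) A mul"
    and unit_closed: "unit \<in> carrier A"
    and aut_mul: "\<And>a b. a \<in> carrier A \<Longrightarrow> b \<in> carrier A \<Longrightarrow>
      aut A (mul (a \<boxtimes>\<^bsub>k,A,A\<^esub> b)) = mul (aut A a \<boxtimes>\<^bsub>k,A,A\<^esub> aut A b)"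
    and aut_unit: "aut A unit = unit"
    and hom_assoc: "\<And>a b c. a \<in> carrier A \<Longrightarrow> b \<in> carrier A \<Longrightarrow> c \<in> carrier A \<Longrightarrow>
      mul (aut A a \<boxtimes>\<^bsub>k,A,A\<^esub> mul (b \<boxtimes>\<^bsub>k,A,A\<^esub> c))
        = mul (mul (a \<boxtimes>\<^bsub>k,A,A\<^esub> b) \<boxtimes>\<^bsub>k,A,A\<^esub> aut A c)"
    and right_unit: "\<And>a. a \<in> carrier A \<Longrightarrow> mul (a \<boxtimes>\<^bsub>k,A,A\<^esub> unit) = aut A a"
    and left_unit: "\<And>a. a \<in> carrier A \<Longrightarrow> mul (unit \<boxtimes>\<^bsub>k,A,A\<^esub> a) = aut A a"

text \<open>Identities in a threefold tensor product are stated in the right-nested one.\<close>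

locale hom_coalgebra = hom_object k C
  for k :: "('k, 'x) ring_scheme" and C :: "('k, 'c, 'y) hom_object_scheme"
    and comul :: "'c \<Rightarrow> ('c, 'c) tensor" and counit :: "'c \<Rightarrow> 'k" +
  assumes comul_linear: "linear_map k C (tensor k C C) comul"
    and counit_linear: "linear_map k C (regular_module k) counit"
    and comul_aut: "\<And>c. c \<in> carrier C \<Longrightarrow>
      comul (aut C c)
        = sweedler (tensor k C C) (comul c) (\<lambda>c1 c2. aut C c1 \<boxtimes>\<^bsub>k,C,C\<^esub> aut C c2)"
    and counit_aut: "\<And>c. c \<in> carrier C \<Longrightarrow> counit (aut C c) = counit c"
    and hom_coassoc: "\<And>c. c \<in> carrier C \<Longrightarrow>
      sweedler (tensor k C (tensor k C C)) (comul c) (\<lambda>c1 c2.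
        sweedler (tensor k C (tensor k C C)) (comul c2) (\<lambda>c21 c22.
          aut_inv C c1 \<boxtimes>\<^bsub>k,C,tensor k C C\<^esub> (c21 \<boxtimes>\<^bsub>k,C,C\<^esub> c22)))
      = sweedler (tensor k C (tensor k C C)) (comul c) (\<lambda>c1 c2.
          sweedler (tensor k C (tensor k C C)) (comul c1) (\<lambda>c11 c12.
            c11 \<boxtimes>\<^bsub>k,C,tensor k C C\<^esub> (c12 \<boxtimes>\<^bsub>k,C,C\<^esub> aut_inv C c2)))"
    and counit_left: "\<And>c. c \<in> carrier C \<Longrightarrow>
      sweedler C (comul c) (\<lambda>c1 c2. counit c1 \<odot>\<^bsub>C\<^esub> c2) = aut_inv C c"
    and counit_right: "\<And>c. c \<in> carrier C \<Longrightarrow>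
      sweedler C (comul c) (\<lambda>c1 c2. counit c2 \<odot>\<^bsub>C\<^esub> c1) = aut_inv C c"

record ('k, 'h) hom_bialgebra = "('k, 'h) hom_object" +
  bmul :: "('h, 'h) tensor \<Rightarrow> 'h"
  bunit :: 'h
  bcomul :: "'h \<Rightarrow> ('h, 'h) tensor"
  bcounit :: "'h \<Rightarrow> 'k"

locale hom_bialgebra =
  alg: hom_algebra k H "bmul H" "bunit H" +
  coalg: hom_coalgebra k H "bcomul H" "bcounit H"
  for k :: "('k, 'x) ring_scheme" and H :: "('k, 'h, 'y) hom_bialgebra_scheme" +
  assumes comul_mul: "\<And>a b. a \<in> carrier H \<Longrightarrow> b \<in> carrier H \<Longrightarrow>
      bcomul H (bmul H (a \<boxtimes>\<^bsub>k,H,H\<^esub> b))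
        = sweedler (tensor k H H) (bcomul H a) (\<lambda>a1 a2.
            sweedler (tensor k H H) (bcomul H b) (\<lambda>b1 b2.
              bmul H (a1 \<boxtimes>\<^bsub>k,H,H\<^esub> b1) \<boxtimes>\<^bsub>k,H,H\<^esub> bmul H (a2 \<boxtimes>\<^bsub>k,H,H\<^esub> b2)))"
    and comul_unit: "bcomul H (bunit H) = bunit H \<boxtimes>\<^bsub>k,H,H\<^esub> bunit H"
    and counit_mul: "\<And>a b. a \<in> carrier H \<Longrightarrow> b \<in> carrier H \<Longrightarrow>
      bcounit H (bmul H (a \<boxtimes>\<^bsub>k,H,H\<^esub> b)) = bcounit H a \<otimes>\<^bsub>k\<^esub> bcounit H b"
    and counit_unit: "bcounit H (bunit H) = \<one>\<^bsub>k\<^esub>"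

locale hom_hopf_algebra = hom_bialgebra k H
  for k :: "('k, 'x) ring_scheme" and H :: "('k, 'h, 'y) hom_bialgebra_scheme" +
  assumes antipode: "\<exists>S. linear_map k H H S \<and>
      (\<forall>h\<in>carrier H. S (aut H h) = aut H (S h)) \<and>
      (\<forall>h\<in>carrier H.
        sweedler H (bcomul H h) (\<lambda>h1 h2. bmul H (S h1 \<boxtimes>\<^bsub>k,H,H\<^esub> h2))
          = bcounit H h \<odot>\<^bsub>H\<^esub> bunit H \<and>
        sweedler H (bcomul H h) (\<lambda>h1 h2. bmul H (h1 \<boxtimes>\<^bsub>k,H,H\<^esub> S h2))
          = bcounit H h \<odot>\<^bsub>H\<^esub> bunit H)"

locale hom_module =
  alg: hom_algebra k A mul unit +
  obj: hom_object k M
  for k :: "('k, 'x) ring_scheme" and A :: "('k, 'a, 'y) hom_object_scheme"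
    and mul :: "('a, 'a) tensor \<Rightarrow> 'a" and unit :: 'a
    and M :: "('k, 'm, 'z) hom_object_scheme" and act :: "('m, 'a) tensor \<Rightarrow> 'm" +
  assumes act_linear: "linear_map k (tensor k M A) M act"
    and aut_act: "\<And>m a. m \<in> carrier M \<Longrightarrow> a \<in> carrier A \<Longrightarrow>
      aut M (act (m \<boxtimes>\<^bsub>k,M,A\<^esub> a)) = act (aut M m \<boxtimes>\<^bsub>k,M,A\<^esub> aut A a)"
    and act_act: "\<And>m a b. m \<in> carrier M \<Longrightarrow> a \<in> carrier A \<Longrightarrow> b \<in> carrier A \<Longrightarrow>
      act (act (m \<boxtimes>\<^bsub>k,M,A\<^esub> a) \<boxtimes>\<^bsub>k,M,A\<^esub> aut A b)
        = act (aut M m \<boxtimes>\<^bsub>k,M,A\<^esub> mul (a \<boxtimes>\<^bsub>k,A,A\<^esub> b))"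
    and act_unit: "\<And>m. m \<in> carrier M \<Longrightarrow> act (m \<boxtimes>\<^bsub>k,M,A\<^esub> unit) = aut M m"

locale hom_comodule =
  coalg: hom_coalgebra k C comul counit +
  obj: hom_object k M
  for k :: "('k, 'x) ring_scheme" and C :: "('k, 'c, 'y) hom_object_scheme"
    and comul :: "'c \<Rightarrow> ('c, 'c) tensor" and counit :: "'c \<Rightarrow> 'k"
    and M :: "('k, 'm, 'z) hom_object_scheme" and coact :: "'m \<Rightarrow> ('m, 'c) tensor" +
  assumes coact_linear: "linear_map k M (tensor k M C) coact"
    and coact_aut: "\<And>m. m \<in> carrier M \<Longrightarrow>
      coact (aut M m)
        = sweedler (tensor k M C) (coact m) (\<lambda>m0 m1. aut M m0 \<boxtimes>\<^bsub>k,M,C\<^esub> aut C m1)"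
    and coact_coassoc: "\<And>m. m \<in> carrier M \<Longrightarrow>
      sweedler (tensor k M (tensor k C C)) (coact m) (\<lambda>m0 m1.
        sweedler (tensor k M (tensor k C C)) (coact m0) (\<lambda>m00 m01.
          m00 \<boxtimes>\<^bsub>k,M,tensor k C C\<^esub> (m01 \<boxtimes>\<^bsub>k,C,C\<^esub> aut_inv C m1)))
      = sweedler (tensor k M (tensor k C C)) (coact m) (\<lambda>m0 m1.
          aut_inv M m0 \<boxtimes>\<^bsub>k,M,tensor k C C\<^esub> comul m1)"
    and coact_counit: "\<And>m. m \<in> carrier M \<Longrightarrow>
      sweedler M (coact m) (\<lambda>m0 m1. counit m1 \<odot>\<^bsub>M\<^esub> m0) = aut_inv M m"

record ('k, 'h, 'a) hom_comodule_algebra = "('k, 'a) hom_object" +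
  amul :: "('a, 'a) tensor \<Rightarrow> 'a"
  aunit :: 'a
  acoact :: "'a \<Rightarrow> ('a, 'h) tensor"

record ('k, 'h, 'c) hom_module_coalgebra = "('k, 'c) hom_object" +
  ccomul :: "'c \<Rightarrow> ('c, 'c) tensor"
  ccounit :: "'c \<Rightarrow> 'k"
  cact :: "('c, 'h) tensor \<Rightarrow> 'c"

locale hom_comodule_algebra =
  bialg: hom_bialgebra k H +
  alg: hom_algebra k A "amul A" "aunit A" +
  comod: hom_comodule k H "bcomul H" "bcounit H" A "acoact A"
  for k :: "('k, 'x) ring_scheme" and H :: "('k, 'h, 'y) hom_bialgebra_scheme"
    and A :: "('k, 'h, 'a, 'z) hom_comodule_algebra_scheme" +
  assumes coact_mul: "\<And>a b. a \<in> carrier A \<Longrightarrow> b \<in> carrier A \<Longrightarrow>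
      acoact A (amul A (a \<boxtimes>\<^bsub>k,A,A\<^esub> b))
        = sweedler (tensor k A H) (acoact A a) (\<lambda>a0 a1.
            sweedler (tensor k A H) (acoact A b) (\<lambda>b0 b1.
              amul A (a0 \<boxtimes>\<^bsub>k,A,A\<^esub> b0) \<boxtimes>\<^bsub>k,A,H\<^esub> bmul H (a1 \<boxtimes>\<^bsub>k,H,H\<^esub> b1)))"
    and coact_unit: "acoact A (aunit A) = aunit A \<boxtimes>\<^bsub>k,A,H\<^esub> bunit H"

locale hom_module_coalgebra =
  bialg: hom_bialgebra k H +
  coalg: hom_coalgebra k C "ccomul C" "ccounit C" +
  mod: hom_module k H "bmul H" "bunit H" C "cact C"
  for k :: "('k, 'x) ring_scheme" and H :: "('k, 'h, 'y) hom_bialgebra_scheme"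
    and C :: "('k, 'h, 'c, 'z) hom_module_coalgebra_scheme" +
  assumes comul_act: "\<And>c h. c \<in> carrier C \<Longrightarrow> h \<in> carrier H \<Longrightarrow>
      ccomul C (cact C (c \<boxtimes>\<^bsub>k,C,H\<^esub> h))
        = sweedler (tensor k C C) (ccomul C c) (\<lambda>c1 c2.
            sweedler (tensor k C C) (bcomul H h) (\<lambda>h1 h2.
              cact C (c1 \<boxtimes>\<^bsub>k,C,H\<^esub> h1) \<boxtimes>\<^bsub>k,C,C\<^esub> cact C (c2 \<boxtimes>\<^bsub>k,C,H\<^esub> h2)))"
    and counit_act: "\<And>c h. c \<in> carrier C \<Longrightarrow> h \<in> carrier H \<Longrightarrow>
      ccounit C (cact C (c \<boxtimes>\<^bsub>k,C,H\<^esub> h)) = ccounit C c \<otimes>\<^bsub>k\<^esub> bcounit H h"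

locale doi_hom_hopf_datum =
  hopf: hom_hopf_algebra k H +
  comod_alg: hom_comodule_algebra k H A +
  mod_coalg: hom_module_coalgebra k H C
  for k :: "('k, 'x) ring_scheme" and H :: "('k, 'h, 'y) hom_bialgebra_scheme"
    and A :: "('k, 'h, 'a, 'z) hom_comodule_algebra_scheme"
    and C :: "('k, 'h, 'c, 'w) hom_module_coalgebra_scheme"

record ('k, 'm, 'a) hom_module = "('k, 'm) hom_object" +
  mact :: "('m, 'a) tensor \<Rightarrow> 'm"

record ('k, 'm, 'a, 'c) doi_module = "('k, 'm, 'a) hom_module" +
  mcoact :: "'m \<Rightarrow> ('m, 'c) tensor"

locale doi_hom_hopf_module =
  datum: doi_hom_hopf_datum k H A C +
  mod: hom_module k A "amul A" "aunit A" M "mact M" +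
  comod: hom_comodule k C "ccomul C" "ccounit C" M "mcoact M"
  for k :: "('k, 'x) ring_scheme" and H :: "('k, 'h, 'y) hom_bialgebra_scheme"
    and A :: "('k, 'h, 'a, 'z) hom_comodule_algebra_scheme"
    and C :: "('k, 'h, 'c, 'w) hom_module_coalgebra_scheme"
    and M :: "('k, 'm, 'a, 'c, 'v) doi_module_scheme" +
  assumes coact_act: "\<And>m a. m \<in> carrier M \<Longrightarrow> a \<in> carrier A \<Longrightarrow>
      mcoact M (mact M (m \<boxtimes>\<^bsub>k,M,A\<^esub> a))
        = sweedler (tensor k M C) (mcoact M m) (\<lambda>m0 m1.
            sweedler (tensor k M C) (acoact A a) (\<lambda>a0 a1.
              mact M (m0 \<boxtimes>\<^bsub>k,M,A\<^esub> a0) \<boxtimes>\<^bsub>k,M,C\<^esub> cact C (m1 \<boxtimes>\<^bsub>k,C,H\<^esub> a1)))"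

definition hom_module_hom ::
  "('k, 'x) ring_scheme \<Rightarrow> ('k, 'a, 'y) hom_object_scheme
    \<Rightarrow> ('k, 'm, 'a, 'z) hom_module_scheme \<Rightarrow> ('k, 'n, 'a, 'w) hom_module_scheme
    \<Rightarrow> ('m \<Rightarrow> 'n) \<Rightarrow> bool" where
  "hom_module_hom k A M N f \<longleftrightarrow>
     hom_object_hom k M N f \<and>
     (\<forall>m\<in>carrier M. \<forall>a\<in>carrier A.
        f (mact M (m \<boxtimes>\<^bsub>k,M,A\<^esub> a)) = mact N (f m \<boxtimes>\<^bsub>k,N,A\<^esub> a))"

definition doi_module_hom ::
  "('k, 'x) ring_scheme \<Rightarrow> ('k, 'a, 'y) hom_object_scheme \<Rightarrow> ('k, 'c, 'u) hom_object_scheme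
    \<Rightarrow> ('k, 'm, 'a, 'c, 'z) doi_module_scheme \<Rightarrow> ('k, 'n, 'a, 'c, 'w) doi_module_scheme
    \<Rightarrow> ('m \<Rightarrow> 'n) \<Rightarrow> bool" where
  "doi_module_hom k A C M N f \<longleftrightarrow>
     hom_module_hom k A M N f \<and>
     (\<forall>m\<in>carrier M.
        mcoact N (f m) = sweedler (tensor k N C) (mcoact M m) (\<lambda>m0 m1. f m0 \<boxtimes>\<^bsub>k,N,C\<^esub> m1))"

text \<open>HOL cannot quantify over types inside a formula, so the test objects range over all Doi
  Hom-Hopf modules whose carrier is a subset of the type \<open>'m\<close> that also contains the carriers of
  \<open>M\<close> and \<open>N\<close>; this type plays the role of a universe. Restricting the test objects can only
  enlarge the class of monomorphisms and epimorphisms.\<close>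

definition doi_mono ::
  "('k, 'x) ring_scheme \<Rightarrow> ('k, 'h, 'y) hom_bialgebra_scheme
    \<Rightarrow> ('k, 'h, 'a, 'z) hom_comodule_algebra_scheme
    \<Rightarrow> ('k, 'h, 'c, 'w) hom_module_coalgebra_scheme
    \<Rightarrow> ('k, 'm, 'a, 'c) doi_module \<Rightarrow> ('k, 'm, 'a, 'c) doi_module \<Rightarrow> ('m \<Rightarrow> 'm) \<Rightarrow> bool" where
  "doi_mono k H A C M N f \<longleftrightarrow>
     doi_module_hom k A C M N f \<and>
     (\<forall>(L :: ('k, 'm, 'a, 'c) doi_module) g h.
        doi_hom_hopf_module k H A C L \<and>
        doi_module_hom k A C L M g \<and> doi_module_hom k A C L M h \<and>
        (\<forall>x\<in>carrier L. f (g x) = f (h x))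
        \<longrightarrow> (\<forall>x\<in>carrier L. g x = h x))"

definition doi_epi ::
  "('k, 'x) ring_scheme \<Rightarrow> ('k, 'h, 'y) hom_bialgebra_scheme
    \<Rightarrow> ('k, 'h, 'a, 'z) hom_comodule_algebra_scheme
    \<Rightarrow> ('k, 'h, 'c, 'w) hom_module_coalgebra_scheme
    \<Rightarrow> ('k, 'm, 'a, 'c) doi_module \<Rightarrow> ('k, 'm, 'a, 'c) doi_module \<Rightarrow> ('m \<Rightarrow> 'm) \<Rightarrow> bool" where
  "doi_epi k H A C M N f \<longleftrightarrow>
     doi_module_hom k A C M N f \<and>
     (\<forall>(L :: ('k, 'm, 'a, 'c) doi_module) g h.
        doi_hom_hopf_module k H A C L \<and>
        doi_module_hom k A C N L g \<and> doi_module_hom k A C N L h \<and>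
        (\<forall>x\<in>carrier M. g (f x) = h (f x))
        \<longrightarrow> (\<forall>x\<in>carrier N. g x = h x))"

text \<open>\<open>Mor X Y g\<close> says that \<open>g\<close> is a morphism from \<open>X\<close> to \<open>Y\<close> in the category in which the
  splitting is required.\<close>

definition has_left_inverse ::
  "(('k, 'm, 'z) module_scheme \<Rightarrow> ('k, 'm, 'z) module_scheme \<Rightarrow> ('m \<Rightarrow> 'm) \<Rightarrow> bool)
    \<Rightarrow> ('k, 'm, 'z) module_scheme \<Rightarrow> ('k, 'm, 'z) module_scheme \<Rightarrow> ('m \<Rightarrow> 'm) \<Rightarrow> bool" where
  "has_left_inverse Mor M N f \<longleftrightarrow> (\<exists>g. Mor N M g \<and> (\<forall>x\<in>carrier M. g (f x) = x))"

definition has_right_inverse ::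
  "(('k, 'm, 'z) module_scheme \<Rightarrow> ('k, 'm, 'z) module_scheme \<Rightarrow> ('m \<Rightarrow> 'm) \<Rightarrow> bool)
    \<Rightarrow> ('k, 'm, 'z) module_scheme \<Rightarrow> ('k, 'm, 'z) module_scheme \<Rightarrow> ('m \<Rightarrow> 'm) \<Rightarrow> bool" where
  "has_right_inverse Mor M N f \<longleftrightarrow> (\<exists>g. Mor N M g \<and> (\<forall>y\<in>carrier N. f (g y) = y))"

definition normalized_integral ::
  "('k, 'x) ring_scheme \<Rightarrow> ('k, 'h, 'y) hom_bialgebra_scheme
    \<Rightarrow> ('k, 'h, 'a, 'z) hom_comodule_algebra_scheme
    \<Rightarrow> ('k, 'h, 'c, 'w) hom_module_coalgebra_scheme
    \<Rightarrow> (('c, 'c) tensor \<Rightarrow> 'a) \<Rightarrow> bool" where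
  "normalized_integral k H A C \<theta> \<longleftrightarrow>
     linear_map k (tensor k C C) A \<theta> \<and>
     (\<forall>t\<in>carrier (tensor k C C).
        \<theta> (sweedler (tensor k C C) t (\<lambda>c d. aut C c \<boxtimes>\<^bsub>k,C,C\<^esub> aut C d)) = aut A (\<theta> t)) \<and>
     (\<forall>c\<in>carrier C. \<forall>d\<in>carrier C.
        sweedler (tensor k A C) (ccomul C c) (\<lambda>c1 c2.
          \<theta> (aut_inv C d \<boxtimes>\<^bsub>k,C,C\<^esub> c1) \<boxtimes>\<^bsub>k,A,C\<^esub> aut C c2)
        = sweedler (tensor k A C) (ccomul C d) (\<lambda>d1 d2.
            sweedler (tensor k A C) (acoact A (\<theta> (d2 \<boxtimes>\<^bsub>k,C,C\<^esub> aut_inv C c))) (\<lambda>t0 t1.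
              aut A t0 \<boxtimes>\<^bsub>k,A,C\<^esub> cact C (d1 \<boxtimes>\<^bsub>k,C,H\<^esub> t1)))) \<and>
     (\<forall>c\<in>carrier C. \<theta> (ccomul C c) = ccounit C c \<odot>\<^bsub>A\<^esub> aunit A) \<and>
     (\<forall>a\<in>carrier A. \<forall>c\<in>carrier C. \<forall>d\<in>carrier C.
        sweedler A (acoact A a) (\<lambda>a0 a1.
          sweedler A (acoact A a0) (\<lambda>a00 a01.
            amul A (aut A (aut A a00) \<boxtimes>\<^bsub>k,A,A\<^esub>
              \<theta> (cact C (aut_inv C d \<boxtimes>\<^bsub>k,C,H\<^esub> a01)
                 \<boxtimes>\<^bsub>k,C,C\<^esub> cact C (aut_inv C c \<boxtimes>\<^bsub>k,C,H\<^esub> aut_inv H a1)))))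
        = amul A (\<theta> (d \<boxtimes>\<^bsub>k,C,C\<^esub> c) \<boxtimes>\<^bsub>k,A,A\<^esub> a))"

end

theory Submission
  imports Defs
begin

text \<open>Composing the structure maps with powers of the automorphisms removes every twist:
  \<open>\<mu>\<^sup>-\<^sup>1(m \<cdot> a)\<close> is an ordinary associative unital action,
  \<open>\<rho>(\<mu>(m))\<close> an ordinary coassociative counital coaction, and
  \<open>\<beta>\<^sup>-\<^sup>1 \<theta>\<close> satisfies the untwisted axioms of an integral. In the untwisted
  setting an \<open>A\<close>-linear morphism \<open>g\<close> from \<open>N\<close> to \<open>M\<close> is averaged to
  \<open>n \<mapsto> g(n\<^sub>0)\<^sub>0 \<theta>(g(n\<^sub>0)\<^sub>1 \<otimes> n\<^sub>1)\<close>.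
  Condition (iii) on \<open>\<theta>\<close> makes this map \<open>A\<close>-linear and condition (i) makes it
  \<open>C\<close>-colinear. If \<open>g\<close> is a left or right inverse of a morphism \<open>f\<close> of Doi
  Hom-Hopf modules, then composing with \<open>f\<close> yields
  \<open>m\<^sub>0\<^sub>0 \<theta>(m\<^sub>0\<^sub>1 \<otimes> m\<^sub>1) = m\<^sub>0 \<theta>(\<Delta>(m\<^sub>1)) = m\<close>
  by condition (ii), so the average is again a left or right inverse.\<close>

section \<open>Linear and bilinear maps\<close>

text \<open>The averaging formula comes from an adjunction. In the untwisted setting the functor
  that forgets the coaction has the right adjoint M \<mapsto> M \<otimes> C, where A acts diagonally
  and C coacts through \<Delta>; the unit of the adjunction is the coaction M \<rightarrow> M
  \<otimes> C. The integral supplies a retraction of this unit that is natural in M, so the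
  forgetful functor is separable and splittings lift along it. Untwisting leaves the morphisms
  alone: a map that commutes with the automorphisms is linear or colinear for the twisted structure
  exactly when it is so for the untwisted one. The formal obstacle is that a Sweedler sum is
  evaluated on a chosen representative of a tensor. Changing the representative is legitimate only
  for bilinear summands, so much of the preparation serves to produce proofs of linearity in each
  variable.\<close>

lemma linear_mapI:
  assumes "\<And>x. x \<in> carrier M \<Longrightarrow> f x \<in> carrier N"
    and "\<And>x y. x \<in> carrier M \<Longrightarrow> y \<in> carrier M \<Longrightarrow> f (x \<oplus>\<^bsub>M\<^esub> y) = f x \<oplus>\<^bsub>N\<^esub> f y"
    and "\<And>r x. r \<in> carrier k \<Longrightarrow> x \<in> carrier M \<Longrightarrow> f (r \<odot>\<^bsub>M\<^esub> x) = r \<odot>\<^bsub>N\<^esub> f x"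
  shows "linear_map k M N f"
  using assms by (auto simp: linear_map_def)

lemma linear_map_closed: "linear_map k M N f \<Longrightarrow> x \<in> carrier M \<Longrightarrow> f x \<in> carrier N"
  and linear_map_add: "linear_map k M N f \<Longrightarrow> x \<in> carrier M \<Longrightarrow> y \<in> carrier M \<Longrightarrow>
    f (x \<oplus>\<^bsub>M\<^esub> y) = f x \<oplus>\<^bsub>N\<^esub> f y"
  and linear_map_smult: "linear_map k M N f \<Longrightarrow> r \<in> carrier k \<Longrightarrow> x \<in> carrier M \<Longrightarrow>
    f (r \<odot>\<^bsub>M\<^esub> x) = r \<odot>\<^bsub>N\<^esub> f x"
  by (auto simp: linear_map_def)

lemma linear_map_zero:
  assumes "Module.module k M" "Module.module k N" "linear_map k M N f"
  shows "f \<zero>\<^bsub>M\<^esub> = \<zero>\<^bsub>N\<^esub>"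
proof -
  interpret M: Module.module k M by fact
  interpret N: Module.module k N by fact
  have c: "f \<zero>\<^bsub>M\<^esub> \<in> carrier N" using assms(3) by (simp add: linear_map_closed)
  have "f \<zero>\<^bsub>M\<^esub> \<oplus>\<^bsub>N\<^esub> f \<zero>\<^bsub>M\<^esub> = f (\<zero>\<^bsub>M\<^esub> \<oplus>\<^bsub>M\<^esub> \<zero>\<^bsub>M\<^esub>)"
    using assms(3) by (simp add: linear_map_add del: M.M.l_zero M.M.r_zero)
  then show ?thesis using c by (simp add: N.M.add.r_cancel_one')
qed

lemma linear_map_ident: "linear_map k M M (\<lambda>x. x)"
  by (auto simp: linear_map_def)

lemma linear_map_compose:
  "linear_map k N P g \<Longrightarrow> linear_map k M N f \<Longrightarrow> linear_map k M P (\<lambda>x. g (f x))"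
  by (auto simp: linear_map_def Pi_iff)

definition bilinear_map ::
  "('k, 'x) ring_scheme \<Rightarrow> ('k, 'm, 'y) module_scheme \<Rightarrow> ('k, 'n, 'z) module_scheme
    \<Rightarrow> ('k, 'p, 'w) module_scheme \<Rightarrow> ('m \<Rightarrow> 'n \<Rightarrow> 'p) \<Rightarrow> bool" where
  "bilinear_map k M N P F \<longleftrightarrow>
     (\<forall>x\<in>carrier M. linear_map k N P (F x)) \<and>
     (\<forall>y\<in>carrier N. linear_map k M P (\<lambda>x. F x y))"

lemma bilinear_mapI:
  "(\<And>x. x \<in> carrier M \<Longrightarrow> linear_map k N P (F x)) \<Longrightarrow>
   (\<And>y. y \<in> carrier N \<Longrightarrow> linear_map k M P (\<lambda>x. F x y)) \<Longrightarrow> bilinear_map k M N P F"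
  by (auto simp: bilinear_map_def)

lemma bilinear_map_right: "bilinear_map k M N P F \<Longrightarrow> x \<in> carrier M \<Longrightarrow> linear_map k N P (F x)"
  and bilinear_map_left: "bilinear_map k M N P F \<Longrightarrow> y \<in> carrier N \<Longrightarrow> linear_map k M P (\<lambda>x. F x y)"
  by (auto simp: bilinear_map_def)

lemma bilinear_map_closed:
  "bilinear_map k M N P F \<Longrightarrow> x \<in> carrier M \<Longrightarrow> y \<in> carrier N \<Longrightarrow> F x y \<in> carrier P"
  by (meson bilinear_map_right linear_map_closed)

lemma linear_map_bilinear_left:
  "bilinear_map k M N P F \<Longrightarrow> linear_map k L M f \<Longrightarrow> y \<in> carrier N \<Longrightarrow>
    linear_map k L P (\<lambda>x. F (f x) y)"
  using linear_map_compose[OF bilinear_map_left] .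

lemma linear_map_bilinear_right:
  "bilinear_map k M N P F \<Longrightarrow> linear_map k L N f \<Longrightarrow> x \<in> carrier M \<Longrightarrow>
    linear_map k L P (\<lambda>y. F x (f y))"
  using linear_map_compose[OF bilinear_map_right] .

section \<open>The tensor product\<close>

text \<open>This is \<open>sweedler\<close> with the choice of a representative stripped off, so
  that identities can be proved by induction on an explicit list.\<close>

definition list_sum ::
  "('k, 'p, 'x) module_scheme \<Rightarrow> ('m \<Rightarrow> 'n \<Rightarrow> 'p) \<Rightarrow> ('m \<times> 'n) list \<Rightarrow> 'p" where
  "list_sum P F u = foldr (\<lambda>(x, y) s. F x y \<oplus>\<^bsub>P\<^esub> s) u \<zero>\<^bsub>P\<^esub>"

lemma list_sum_simps [simp]:
  "list_sum P F [] = \<zero>\<^bsub>P\<^esub>"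
  "list_sum P F ((x, y) # u) = F x y \<oplus>\<^bsub>P\<^esub> list_sum P F u"
  by (auto simp: list_sum_def)

lemma sweedler_list_sum: "sweedler P t F = list_sum P F (SOME u. u \<in> t)"
  by (simp add: sweedler_def list_sum_def)

lemma list_sum_cong:
  assumes "u \<in> lists (carrier M \<times> carrier N)"
    and "\<And>x y. x \<in> carrier M \<Longrightarrow> y \<in> carrier N \<Longrightarrow> F x y = G x y"
  shows "list_sum P F u = list_sum P G u"
  using assms(1) by (induction u) (auto simp: assms(2))

context Module.module
begin

lemma list_sum_closed:
  assumes "u \<in> lists (carrier X \<times> carrier Y)"
    and "\<And>x y. x \<in> carrier X \<Longrightarrow> y \<in> carrier Y \<Longrightarrow> F x y \<in> carrier M"
  shows "list_sum M F u \<in> carrier M"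
  using assms(1) by (induction u) (auto simp: assms(2))

lemma list_sum_append:
  assumes "u \<in> lists (carrier X \<times> carrier Y)" "v \<in> lists (carrier X \<times> carrier Y)"
    and F: "\<And>x y. x \<in> carrier X \<Longrightarrow> y \<in> carrier Y \<Longrightarrow> F x y \<in> carrier M"
  shows "list_sum M F (u @ v) = list_sum M F u \<oplus>\<^bsub>M\<^esub> list_sum M F v"
  using assms(1)
proof (induction u)
  case Nil
  then show ?case using list_sum_closed[OF assms(2) F] by simp
next
  case (Cons p u)
  then show ?case
    using list_sum_closed[OF assms(2) F] list_sum_closed[of u X Y F, OF _ F]
    by (cases p) (simp add: F M.a_assoc)
qed

lemma list_sum_add:
  assumes "u \<in> lists (carrier X \<times> carrier Y)"
    and F: "\<And>x y. x \<in> carrier X \<Longrightarrow> y \<in> carrier Y \<Longrightarrow> F x y \<in> carrier M"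
    and G: "\<And>x y. x \<in> carrier X \<Longrightarrow> y \<in> carrier Y \<Longrightarrow> G x y \<in> carrier M"
  shows "list_sum M (\<lambda>x y. F x y \<oplus>\<^bsub>M\<^esub> G x y) u = list_sum M F u \<oplus>\<^bsub>M\<^esub> list_sum M G u"
  using assms(1)
proof (induction u)
  case (Cons p u)
  then show ?case
    using list_sum_closed[of u X Y F, OF _ F] list_sum_closed[of u X Y G, OF _ G]
    by (cases p) (simp add: F G M.a_ac)
qed simp

lemma list_sum_linear:
  assumes "Module.module R P" "linear_map R M P L" "u \<in> lists (carrier X \<times> carrier Y)"
    and F: "\<And>x y. x \<in> carrier X \<Longrightarrow> y \<in> carrier Y \<Longrightarrow> F x y \<in> carrier M"
  shows "L (list_sum M F u) = list_sum P (\<lambda>x y. L (F x y)) u"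
  using assms(3)
proof (induction u)
  case Nil
  show ?case using linear_map_zero[OF module_axioms assms(1,2)] by simp
next
  case (Cons p u)
  then show ?case
    using list_sum_closed[of u X Y F, OF _ F] linear_map_add[OF assms(2)]
    by (cases p) (simp add: F)
qed

lemma linear_map_list_sum:
  assumes "u \<in> lists (carrier X \<times> carrier Y)"
    and F: "\<And>x y. x \<in> carrier X \<Longrightarrow> y \<in> carrier Y \<Longrightarrow> linear_map R L M (\<lambda>z. F z x y)"
  shows "linear_map R L M (\<lambda>z. list_sum M (F z) u)"
  using assms(1)
proof (induction u)
  case Nil
  show ?case by (rule linear_mapI) auto
next
  case (Cons p u)
  obtain x y where p: "p = (x, y)" by fastforce
  have l: "linear_map R L M (\<lambda>z. F z x y)" "linear_map R L M (\<lambda>z. list_sum M (F z) u)"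
    using Cons F by (auto simp: p)
  show ?case
    unfolding p list_sum_simps
    by (rule linear_mapI)
      (simp_all add: l[THEN linear_map_closed] l[THEN linear_map_add] l[THEN linear_map_smult]
        M.a_ac smult_r_distr)
qed

lemma list_sum_swap:
  assumes u: "u \<in> lists (carrier X \<times> carrier Y)" and v: "v \<in> lists (carrier X' \<times> carrier Y')"
    and F: "\<And>x y z w. x \<in> carrier X \<Longrightarrow> y \<in> carrier Y \<Longrightarrow> z \<in> carrier X' \<Longrightarrow> w \<in> carrier Y' \<Longrightarrow>
      F x y z w \<in> carrier M"
  shows "list_sum M (\<lambda>x y. list_sum M (F x y) v) u
    = list_sum M (\<lambda>z w. list_sum M (\<lambda>x y. F x y z w) u) v"
  using u
proof (induction u)
  case Nil
  have "list_sum M (\<lambda>z w. \<zero>\<^bsub>M\<^esub>) v = \<zero>\<^bsub>M\<^esub>" using v by (induction v) auto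
  then show ?case by simp
next
  case (Cons p u)
  obtain x y where p: "p = (x, y)" by fastforce
  have xy: "x \<in> carrier X" "y \<in> carrier Y" and u: "u \<in> lists (carrier X \<times> carrier Y)"
    using Cons.hyps by (auto simp: p)
  show ?case
    using Cons.IH list_sum_add[of v X' Y' "F x y" "\<lambda>z w. list_sum M (\<lambda>x y. F x y z w) u", OF v]
    by (simp add: p xy F list_sum_closed[OF u])
qed

end

text \<open>A representative picked by choice is only known to be congruent to a given list. Every
  generator relates lists over the carriers, so congruence alone puts its entries there.\<close>

lemma tensor_cong_lists:
  assumes "Module.module k M" "Module.module k N" "tensor_cong k M N u v"
  shows "u \<in> lists (carrier M \<times> carrier N) \<and> v \<in> lists (carrier M \<times> carrier N)"
proof -
  interpret M: Module.module k M by fact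
  interpret N: Module.module k N by fact
  show ?thesis using assms(3) by (induction) auto
qed

text \<open>The universal property at the level of formal sums: each generator of the congruence is
  an identity that bilinear maps satisfy.\<close>

lemma tensor_cong_list_sum:
  assumes "Module.module k M" "Module.module k N" "Module.module k P"
    and F: "bilinear_map k M N P F" and "tensor_cong k M N u v"
  shows "list_sum P F u = list_sum P F v"
proof -
  interpret M: Module.module k M by fact
  interpret N: Module.module k N by fact
  interpret P: Module.module k P by fact
  have c[simp]: "x \<in> carrier M \<Longrightarrow> y \<in> carrier N \<Longrightarrow> F x y \<in> carrier P" for x y
    using bilinear_map_closed[OF F] .
  note lr = bilinear_map_right[OF F] bilinear_map_left[OF F]
  note lists = tensor_cong_lists[OF assms(1,2)]
  show ?thesis using assms(5)
  proof induction
    case (append u u' v v')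
    then show ?case using lists[OF append(1)] lists[OF append(2)]
      by (simp add: P.list_sum_append[of _ M N])
  next
    case (commute u v)
    then show ?case
      by (simp add: P.list_sum_append[of _ M N] P.list_sum_closed[of _ M N] P.M.a_comm)
  next
    case (zero_left n)
    then show ?case using linear_map_zero[OF assms(1,3) lr(2)] by simp
  next
    case (zero_right m)
    then show ?case using linear_map_zero[OF assms(2,3) lr(1)] by simp
  next
    case (add_left m m' n)
    then show ?case using linear_map_add[OF lr(2)] by simp
  next
    case (add_right m n n')
    then show ?case using linear_map_add[OF lr(1)] by simp
  next
    case (smult r m n)
    then show ?case using linear_map_smult[OF lr(1)] linear_map_smult[OF lr(2)] by simp
  qed auto
qed

section \<open>The tensor product as a module, and Sweedler sums\<close>

locale module_pair = M: Module.module k M + N: Module.module k N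
  for k :: "('k, 'x) ring_scheme" and M :: "('k, 'm, 'y) module_scheme"
    and N :: "('k, 'n, 'z) module_scheme"
begin

abbreviation "fsums \<equiv> lists (carrier M \<times> carrier N)"
abbreviation "T \<equiv> tensor k M N"
abbreviation "cls \<equiv> tensor_class k M N"

lemmas cong_lists = tensor_cong_lists[OF M.module_axioms N.module_axioms]
lemmas cong_list_sum = tensor_cong_list_sum[OF M.module_axioms N.module_axioms]

lemma class_eq:
  assumes "tensor_cong k M N u v"
  shows "cls u = cls v"
  unfolding tensor_class_def
  using tensor_cong.trans[OF assms] tensor_cong.trans[OF tensor_cong.sym[OF assms]] by blast

lemma in_classD: "v \<in> cls u \<Longrightarrow> tensor_cong k M N u v"
  by (simp add: tensor_class_def)

lemma class_self: "u \<in> fsums \<Longrightarrow> u \<in> cls u"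
  by (simp add: tensor_class_def tensor_cong.refl)

lemma carrier_tensor: "t \<in> carrier T \<longleftrightarrow> (\<exists>u\<in>fsums. t = cls u)"
  by (auto simp: tensor_def)

lemma class_closed: "u \<in> fsums \<Longrightarrow> cls u \<in> carrier T"
  unfolding carrier_tensor by blast

lemma tensor_zero: "\<zero>\<^bsub>T\<^esub> = cls []"
  by (simp add: tensor_def)

text \<open>Addition is a union over all pairs of representatives. The classes in this union
  coincide because the congruence is compatible with appending, and the union is not empty, so it
  collapses to a single class.\<close>

lemma tensor_add:
  assumes "u \<in> fsums" "v \<in> fsums"
  shows "cls u \<oplus>\<^bsub>T\<^esub> cls v = cls (u @ v)"
proof -
  have "cls (u' @ v') = cls (u @ v)" if "u' \<in> cls u" "v' \<in> cls v" for u' v'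
    using that by (intro class_eq[symmetric] tensor_cong.append in_classD)
  then have "cls u \<oplus>\<^bsub>T\<^esub> cls v = (\<Union>u'\<in>cls u. \<Union>v'\<in>cls v. cls (u @ v))"
    unfolding tensor_def by simp
  also have "\<dots> = cls (u @ v)"
    using class_self[OF assms(1)] class_self[OF assms(2)] by blast
  finally show ?thesis .
qed

abbreviation "scale r \<equiv> map (\<lambda>(m, n). (r \<odot>\<^bsub>M\<^esub> m, n))"

lemma scale_closed: "r \<in> carrier k \<Longrightarrow> u \<in> fsums \<Longrightarrow> scale r u \<in> fsums"
  by (induction u) auto

lemma scale_cong:
  assumes r: "r \<in> carrier k" and "tensor_cong k M N u v"
  shows "tensor_cong k M N (scale r u) (scale r v)"
  using assms(2)
proof induction
  case (refl u)
  then show ?case by (intro tensor_cong.refl scale_closed[OF r])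
next
  case (commute u v)
  then show ?case by (simp add: tensor_cong.commute scale_closed[OF r])
next
  case (smult s m n)
  \<comment> \<open>Scaling acts on the left entry, where the factor \<open>s\<close> already sits;
    the two scalars change places by commutativity of \<open>k\<close>.\<close>
  have "r \<odot>\<^bsub>M\<^esub> (s \<odot>\<^bsub>M\<^esub> m) = s \<odot>\<^bsub>M\<^esub> (r \<odot>\<^bsub>M\<^esub> m)"
    using smult r by (metis M.smult_assoc1 M.m_comm)
  then show ?case using smult r by (auto intro!: tensor_cong.smult)
next
  case (sym u v)
  then show ?case by (blast intro: tensor_cong.sym)
next
  case (trans u v w)
  then show ?case by (blast intro: tensor_cong.trans)
qed (auto simp: r M.smult_r_distr intro: tensor_cong.append tensor_cong.zero_left
    tensor_cong.zero_right tensor_cong.add_left tensor_cong.add_right)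

lemma tensor_smult:
  assumes "r \<in> carrier k" "u \<in> fsums"
  shows "r \<odot>\<^bsub>T\<^esub> cls u = cls (scale r u)"
proof -
  have "cls (scale r u') = cls (scale r u)" if "u' \<in> cls u" for u'
    using that assms(1) by (intro class_eq[symmetric] scale_cong in_classD)
  then have "r \<odot>\<^bsub>T\<^esub> cls u = (\<Union>u'\<in>cls u. cls (scale r u))"
    unfolding tensor_def by simp
  also have "\<dots> = cls (scale r u)" using class_self[OF assms(2)] by blast
  finally show ?thesis .
qed

text \<open>Splitting each scaled pair in two puts its pieces for \<open>r\<close> and
  \<open>s\<close> side by side, whereas the right-hand side lists all pieces for \<open>r\<close>
  first. The lists are therefore only congruent, and the inductive step moves one piece for
  \<open>s\<close> past \<open>scale r u\<close>.\<close>

lemma scale_add_cong: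
  assumes r: "r \<in> carrier k" and s: "s \<in> carrier k" and "u \<in> fsums"
  shows "cls (scale (r \<oplus>\<^bsub>k\<^esub> s) u) = cls (scale r u @ scale s u)"
  using assms(3)
proof (induction u)
  case Nil
  show ?case by simp
next
  case (Cons p u)
  obtain m n where p: "p = (m, n)" by fastforce
  have m: "m \<in> carrier M" "n \<in> carrier N" and u: "u \<in> fsums" using Cons.hyps by (auto simp: p)
  note sc = scale_closed[OF _ u]
  let ?a = "[(r \<odot>\<^bsub>M\<^esub> m, n)]" and ?b = "[(s \<odot>\<^bsub>M\<^esub> m, n)]"
  have ab: "?a \<in> fsums" "?b \<in> fsums" using m r s by auto
  have 1: "cls [((r \<oplus>\<^bsub>k\<^esub> s) \<odot>\<^bsub>M\<^esub> m, n)] = cls (?a @ ?b)"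
    using m r s by (auto intro!: class_eq tensor_cong.add_left simp: M.smult_l_distr)
  have "cls (scale (r \<oplus>\<^bsub>k\<^esub> s) (p # u))
      = cls [((r \<oplus>\<^bsub>k\<^esub> s) \<odot>\<^bsub>M\<^esub> m, n)] \<oplus>\<^bsub>T\<^esub> cls (scale (r \<oplus>\<^bsub>k\<^esub> s) u)"
    using m r s sc by (subst tensor_add) (auto simp: p)
  also have "\<dots> = cls (?a @ ?b) \<oplus>\<^bsub>T\<^esub> cls (scale r u @ scale s u)"
    by (simp only: 1 Cons.IH)
  also have "\<dots> = cls (?a @ ((?b @ scale r u) @ scale s u))"
    using ab r s sc by (subst tensor_add) auto
  also have "\<dots> = cls (?a @ ((scale r u @ ?b) @ scale s u))"
    using tensor_cong.append[OF tensor_cong.refl[OF ab(1)] tensor_cong.append[OF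
          tensor_cong.commute[OF ab(2) sc[OF r]] tensor_cong.refl[OF sc[OF s]]]]
    by (rule class_eq)
  finally show ?case by (simp add: p)
qed

lemma scale_scale: "r \<in> carrier k \<Longrightarrow> s \<in> carrier k \<Longrightarrow> u \<in> fsums \<Longrightarrow>
    scale (r \<otimes>\<^bsub>k\<^esub> s) u = scale r (scale s u)"
  by (induction u) (auto simp: M.smult_assoc1)

lemma scale_one: "u \<in> fsums \<Longrightarrow> scale \<one>\<^bsub>k\<^esub> u = u"
  by (induction u) auto

lemma scale_zero: "u \<in> fsums \<Longrightarrow> cls (scale \<zero>\<^bsub>k\<^esub> u) = cls []"
proof (induction u)
  case (Cons p u)
  then have "cls ([(\<zero>\<^bsub>M\<^esub>, snd p)] @ scale \<zero>\<^bsub>k\<^esub> u) = cls ([] @ scale \<zero>\<^bsub>k\<^esub> u)"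
    by (intro class_eq tensor_cong.append tensor_cong.zero_left tensor_cong.refl scale_closed) auto
  with Cons show ?case by (cases p) auto
qed simp

lemma tensor_module: "Module.module k T"
proof (rule moduleI)
  show "abelian_group T"
  proof (rule abelian_groupI)
    fix s assume "s \<in> carrier T"
    then obtain u where u: "u \<in> fsums" "s = cls u" by (auto simp: carrier_tensor)
    \<comment> \<open>Negatives arise by scaling with -1: the sum with \<open>s\<close> is then
      \<open>s\<close> scaled by -1 + 1 = 0.\<close>
    let ?n = "\<ominus>\<^bsub>k\<^esub> \<one>\<^bsub>k\<^esub>"
    have "cls (scale ?n u) \<oplus>\<^bsub>T\<^esub> s = cls (scale ?n u @ scale \<one>\<^bsub>k\<^esub> u)"
      using u by (simp add: tensor_add scale_closed scale_one)
    also have "\<dots> = \<zero>\<^bsub>T\<^esub>"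
      using scale_add_cong[of ?n "\<one>\<^bsub>k\<^esub>" u] u
      by (simp add: tensor_zero scale_zero M.R.l_neg)
    finally show "\<exists>y\<in>carrier T. y \<oplus>\<^bsub>T\<^esub> s = \<zero>\<^bsub>T\<^esub>"
      using u class_closed scale_closed by (metis M.R.add.inv_closed M.R.one_closed)
  next
    fix s t assume "s \<in> carrier T" "t \<in> carrier T"
    then obtain u v where uv: "u \<in> fsums" "s = cls u" "v \<in> fsums" "t = cls v"
      by (auto simp: carrier_tensor)
    then show "s \<oplus>\<^bsub>T\<^esub> t \<in> carrier T"
      using class_closed[of "u @ v"] by (simp add: tensor_add del: in_lists_conv_set)
    show "s \<oplus>\<^bsub>T\<^esub> t = t \<oplus>\<^bsub>T\<^esub> s"
      using uv class_eq[OF tensor_cong.commute, of u v]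
      by (simp add: tensor_add del: in_lists_conv_set)
    fix r assume "r \<in> carrier T"
    then obtain w where "w \<in> fsums" "r = cls w" by (auto simp: carrier_tensor)
    with uv show "s \<oplus>\<^bsub>T\<^esub> t \<oplus>\<^bsub>T\<^esub> r = s \<oplus>\<^bsub>T\<^esub> (t \<oplus>\<^bsub>T\<^esub> r)"
      by (simp add: tensor_add del: in_lists_conv_set)
  next
    show "\<zero>\<^bsub>T\<^esub> \<in> carrier T" using class_closed[of "[]"] by (simp add: tensor_zero)
  next
    fix s assume "s \<in> carrier T"
    then obtain u where u: "u \<in> fsums" "s = cls u" by (auto simp: carrier_tensor)
    then show "\<zero>\<^bsub>T\<^esub> \<oplus>\<^bsub>T\<^esub> s = s"
      using tensor_add[of "[]" u] by (simp add: tensor_zero del: in_lists_conv_set)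
  qed
next
  fix r s assume s: "s \<in> carrier T" and r: "r \<in> carrier k"
  then obtain u where u: "u \<in> fsums" "s = cls u" by (auto simp: carrier_tensor)
  show "r \<odot>\<^bsub>T\<^esub> s \<in> carrier T"
    using u r class_closed scale_closed by (simp add: tensor_smult del: in_lists_conv_set)
  fix q assume q: "q \<in> carrier k"
  show "(r \<oplus>\<^bsub>k\<^esub> q) \<odot>\<^bsub>T\<^esub> s = r \<odot>\<^bsub>T\<^esub> s \<oplus>\<^bsub>T\<^esub> q \<odot>\<^bsub>T\<^esub> s"
    using u r q by (simp add: tensor_smult tensor_add scale_add_cong scale_closed
        del: in_lists_conv_set map_append)
  show "(r \<otimes>\<^bsub>k\<^esub> q) \<odot>\<^bsub>T\<^esub> s = r \<odot>\<^bsub>T\<^esub> (q \<odot>\<^bsub>T\<^esub> s)"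
    using u r q by (simp add: tensor_smult scale_scale scale_closed
        del: in_lists_conv_set map_map)
next
  fix s assume "s \<in> carrier T"
  then obtain u where u: "u \<in> fsums" "s = cls u" by (auto simp: carrier_tensor)
  then show "\<one>\<^bsub>k\<^esub> \<odot>\<^bsub>T\<^esub> s = s"
    by (simp add: tensor_smult scale_one del: in_lists_conv_set)
next
  fix r s t assume "s \<in> carrier T" "t \<in> carrier T" "r \<in> carrier k"
  then obtain u v where "u \<in> fsums" "s = cls u" "v \<in> fsums" "t = cls v"
    by (auto simp: carrier_tensor)
  with \<open>r \<in> carrier k\<close> show "r \<odot>\<^bsub>T\<^esub> (s \<oplus>\<^bsub>T\<^esub> t) = r \<odot>\<^bsub>T\<^esub> s \<oplus>\<^bsub>T\<^esub> r \<odot>\<^bsub>T\<^esub> t"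
    using scale_closed[of r u] scale_closed[of r v]
    by (simp add: tensor_smult tensor_add del: in_lists_conv_set)
qed (rule M.is_cring)

lemma pure_closed: "x \<in> carrier M \<Longrightarrow> y \<in> carrier N \<Longrightarrow> x \<boxtimes>\<^bsub>k,M,N\<^esub> y \<in> carrier T"
  by (auto simp: pure_tensor_def intro: class_closed)

lemma pure_bilinear: "bilinear_map k M N T (\<lambda>x y. x \<boxtimes>\<^bsub>k,M,N\<^esub> y)"
proof (intro bilinear_mapI linear_mapI)
  fix r x y assume *: "x \<in> carrier M" "r \<in> carrier k" "y \<in> carrier N"
  have "cls [(x, r \<odot>\<^bsub>N\<^esub> y)] = cls [(r \<odot>\<^bsub>M\<^esub> x, y)]"
    using * by (intro class_eq tensor_cong.sym[OF tensor_cong.smult])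
  then show "x \<boxtimes>\<^bsub>k,M,N\<^esub> (r \<odot>\<^bsub>N\<^esub> y) = r \<odot>\<^bsub>T\<^esub> (x \<boxtimes>\<^bsub>k,M,N\<^esub> y)"
    using * by (simp add: pure_tensor_def tensor_smult)
next
  fix x y y' assume "x \<in> carrier M" "y \<in> carrier N" "y' \<in> carrier N"
  then show "x \<boxtimes>\<^bsub>k,M,N\<^esub> (y \<oplus>\<^bsub>N\<^esub> y') = (x \<boxtimes>\<^bsub>k,M,N\<^esub> y) \<oplus>\<^bsub>T\<^esub> (x \<boxtimes>\<^bsub>k,M,N\<^esub> y')"
    using class_eq[OF tensor_cong.add_right] by (simp add: pure_tensor_def tensor_add)
next
  fix x x' y assume "x \<in> carrier M" "x' \<in> carrier M" "y \<in> carrier N"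
  then show "(x \<oplus>\<^bsub>M\<^esub> x') \<boxtimes>\<^bsub>k,M,N\<^esub> y = (x \<boxtimes>\<^bsub>k,M,N\<^esub> y) \<oplus>\<^bsub>T\<^esub> (x' \<boxtimes>\<^bsub>k,M,N\<^esub> y)"
    using class_eq[OF tensor_cong.add_left] by (simp add: pure_tensor_def tensor_add)
next
  fix r x y assume "x \<in> carrier M" "r \<in> carrier k" "y \<in> carrier N"
  then show "(r \<odot>\<^bsub>M\<^esub> x) \<boxtimes>\<^bsub>k,M,N\<^esub> y = r \<odot>\<^bsub>T\<^esub> (x \<boxtimes>\<^bsub>k,M,N\<^esub> y)"
    by (simp add: pure_tensor_def tensor_smult)
qed (auto intro: pure_closed)

lemma tensor_repr:
  assumes "t \<in> carrier T"
  shows "(SOME u. u \<in> t) \<in> fsums" and "cls (SOME u. u \<in> t) = t"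
proof -
  obtain v where v: "v \<in> fsums" "t = cls v" using assms by (auto simp: carrier_tensor)
  then have "(SOME u. u \<in> t) \<in> t" by (intro someI) (auto intro: class_self)
  then have *: "tensor_cong k M N v (SOME u. u \<in> t)" by (simp add: v(2) in_classD)
  show "(SOME u. u \<in> t) \<in> fsums" using cong_lists[OF *] by blast
  show "cls (SOME u. u \<in> t) = t" using class_eq[OF *] v(2) by simp
qed

text \<open>Independence of the representative: the list picked by choice is congruent to
  \<open>u\<close>, and a bilinear summand does not see the difference.\<close>

lemma sweedler_class:
  assumes "Module.module k P" "bilinear_map k M N P F" "u \<in> fsums"
  shows "sweedler P (cls u) F = list_sum P F u"
proof -
  note u = tensor_repr[OF class_closed[OF assms(3)]]
  have "tensor_cong k M N u (SOME v. v \<in> cls u)"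
    using in_classD class_self[OF u(1)] u(2) by simp
  then show ?thesis using cong_list_sum[OF assms(1,2)] by (simp add: sweedler_list_sum)
qed

lemma sweedler_pure:
  assumes "Module.module k P" "bilinear_map k M N P F" "x \<in> carrier M" "y \<in> carrier N"
  shows "sweedler P (x \<boxtimes>\<^bsub>k,M,N\<^esub> y) F = F x y"
proof -
  interpret P: Module.module k P by fact
  show ?thesis
    using assms bilinear_map_closed[OF assms(2-4)]
    by (simp add: pure_tensor_def sweedler_class)
qed

text \<open>In this rule and the next three, one tensor with one chosen list occurs on both sides,
  so they do not depend on bilinearity of the summand in the two tensor factors.\<close>

lemma sweedler_cong:
  assumes "t \<in> carrier T"
    and "\<And>x y. x \<in> carrier M \<Longrightarrow> y \<in> carrier N \<Longrightarrow> F x y = G x y"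
  shows "sweedler P t F = sweedler P t G"
proof -
  show ?thesis
    unfolding sweedler_list_sum using list_sum_cong[OF tensor_repr(1)[OF assms(1)] assms(2)] .
qed

lemma sweedler_closed:
  assumes "Module.module k P" "t \<in> carrier T"
    and "\<And>x y. x \<in> carrier M \<Longrightarrow> y \<in> carrier N \<Longrightarrow> F x y \<in> carrier P"
  shows "sweedler P t F \<in> carrier P"
proof -
  interpret P: Module.module k P by fact
  show ?thesis
    unfolding sweedler_list_sum using P.list_sum_closed[OF tensor_repr(1)[OF assms(2)] assms(3)] .
qed

lemma linear_map_sweedler:
  assumes "Module.module k P" "Module.module k Q" "linear_map k P Q L" "t \<in> carrier T"
    and "\<And>x y. x \<in> carrier M \<Longrightarrow> y \<in> carrier N \<Longrightarrow> F x y \<in> carrier P"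
  shows "L (sweedler P t F) = sweedler Q t (\<lambda>x y. L (F x y))"
proof -
  interpret P: Module.module k P by fact
  show ?thesis
    unfolding sweedler_list_sum
    by (rule P.list_sum_linear[OF assms(2,3) tensor_repr(1)[OF assms(4)] assms(5)])
qed

lemma sweedler_linear_param:
  assumes "Module.module k P" "t \<in> carrier T"
    and "\<And>x y. x \<in> carrier M \<Longrightarrow> y \<in> carrier N \<Longrightarrow> linear_map k L P (\<lambda>z. F z x y)"
  shows "linear_map k L P (\<lambda>z. sweedler P t (F z))"
proof -
  interpret P: Module.module k P by fact
  show ?thesis
    unfolding sweedler_list_sum using P.linear_map_list_sum[OF tensor_repr(1)[OF assms(2)] assms(3)] .
qed

text \<open>Here the tensor itself varies. The chosen list of a sum is unrelated to those of its
  terms, and bilinearity of \<open>F\<close> is what allows passing to the concatenated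
  list.\<close>

lemma sweedler_linear:
  assumes P: "Module.module k P" and F: "bilinear_map k M N P F"
  shows "linear_map k T P (\<lambda>t. sweedler P t F)"
proof -
  interpret P: Module.module k P by fact
  note c = bilinear_map_closed[OF F]
  have s: "list_sum P F (scale r u) = r \<odot>\<^bsub>P\<^esub> list_sum P F u"
    if "r \<in> carrier k" "u \<in> fsums" for r u
    using that(2)
  proof (induction u)
    case Nil
    show ?case using that(1) by simp
  next
    case (Cons p u)
    then show ?case
      using that(1) P.list_sum_closed[of u M N F, OF _ c] linear_map_smult[OF bilinear_map_left[OF F]]
      by (cases p) (auto simp: c P.smult_r_distr)
  qed
  show ?thesis
  proof (rule linear_mapI)
    fix t assume "t \<in> carrier T"
    then obtain u where u: "u \<in> fsums" "t = cls u" by (auto simp: carrier_tensor)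
    show "sweedler P t F \<in> carrier P"
      unfolding u(2) sweedler_class[OF P F u(1)] by (rule P.list_sum_closed[OF u(1) c])
    {
      fix s assume "s \<in> carrier T"
      then obtain v where v: "v \<in> fsums" "s = cls v" by (auto simp: carrier_tensor)
      have "u @ v \<in> fsums" using u(1) v(1) by simp
      then show "sweedler P (t \<oplus>\<^bsub>T\<^esub> s) F = sweedler P t F \<oplus>\<^bsub>P\<^esub> sweedler P s F"
        unfolding u(2) v(2) tensor_add[OF u(1) v(1)]
        using P.list_sum_append[OF u(1) v(1) c] u(1) v(1)
        by (simp add: sweedler_class[OF P F] del: in_lists_conv_set append_in_lists_conv)
    }
    fix r assume "r \<in> carrier k"
    then show "sweedler P (r \<odot>\<^bsub>T\<^esub> t) F = r \<odot>\<^bsub>P\<^esub> sweedler P t F"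
      unfolding u(2) using u(1)
      by (simp add: sweedler_class[OF P F] tensor_smult scale_closed s del: in_lists_conv_set)
  qed
qed

text \<open>Summing pure tensors concatenates the representative again. The identity turns a map
  applied to a whole comultiplication into a Sweedler sum.\<close>

lemma sweedler_self:
  assumes "t \<in> carrier T"
  shows "sweedler T t (\<lambda>x y. x \<boxtimes>\<^bsub>k,M,N\<^esub> y) = t"
proof -
  have "list_sum T (\<lambda>x y. x \<boxtimes>\<^bsub>k,M,N\<^esub> y) u = cls u" if "u \<in> fsums" for u
    using that
  proof (induction u)
    case (Cons p u)
    then show ?case
      using tensor_add[of "[p]" u] by (cases p) (simp add: pure_tensor_def)
  qed (simp add: tensor_zero)
  then show ?thesis using tensor_repr[OF assms] by (simp add: sweedler_list_sum)
qed

end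

text \<open>Substitution of one Sweedler sum into another: evaluation of \<open>F\<close> is a
  linear map on \<open>tensor k M N\<close>, and linear maps pass through sums.\<close>

lemma sweedler_sweedler:
  assumes "Module.module k X" "Module.module k Y" "Module.module k M" "Module.module k N"
    and "Module.module k P" "bilinear_map k M N P F" "t \<in> carrier (tensor k X Y)"
    and "\<And>x y. x \<in> carrier X \<Longrightarrow> y \<in> carrier Y \<Longrightarrow> G x y \<in> carrier (tensor k M N)"
  shows "sweedler P (sweedler (tensor k M N) t G) F = sweedler P t (\<lambda>x y. sweedler P (G x y) F)"
proof -
  interpret X: module_pair k X Y by (simp add: module_pair.intro assms)
  interpret M: module_pair k M N by (simp add: module_pair.intro assms)
  show ?thesis
    by (rule X.linear_map_sweedler[OF M.tensor_module assms(5) M.sweedler_linear[OF assms(5,6)]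
          assms(7,8)])
qed

lemma sweedler_sweedler_pure:
  assumes "Module.module k X" "Module.module k Y" "Module.module k M" "Module.module k N"
    and "Module.module k P" "bilinear_map k M N P F" "t \<in> carrier (tensor k X Y)"
    and "\<And>x y. x \<in> carrier X \<Longrightarrow> y \<in> carrier Y \<Longrightarrow> G x y \<in> carrier M"
    and "\<And>x y. x \<in> carrier X \<Longrightarrow> y \<in> carrier Y \<Longrightarrow> G' x y \<in> carrier N"
  shows "sweedler P (sweedler (tensor k M N) t (\<lambda>x y. G x y \<boxtimes>\<^bsub>k,M,N\<^esub> G' x y)) F
    = sweedler P t (\<lambda>x y. F (G x y) (G' x y))"
proof -
  interpret X: module_pair k X Y by (simp add: module_pair.intro assms)
  interpret M: module_pair k M N by (simp add: module_pair.intro assms)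
  have "sweedler P (sweedler (tensor k M N) t (\<lambda>x y. G x y \<boxtimes>\<^bsub>k,M,N\<^esub> G' x y)) F
    = sweedler P t (\<lambda>x y. sweedler P (G x y \<boxtimes>\<^bsub>k,M,N\<^esub> G' x y) F)"
    using assms by (intro sweedler_sweedler) (auto intro: M.pure_closed)
  also have "\<dots> = sweedler P t (\<lambda>x y. F (G x y) (G' x y))"
    using assms by (intro X.sweedler_cong M.sweedler_pure) auto
  finally show ?thesis .
qed

lemma sweedler_swap:
  assumes "Module.module k X" "Module.module k Y" "Module.module k X'" "Module.module k Y'"
    and "Module.module k P" "s \<in> carrier (tensor k X Y)" "t \<in> carrier (tensor k X' Y')"
    and "\<And>x y z w. x \<in> carrier X \<Longrightarrow> y \<in> carrier Y \<Longrightarrow> z \<in> carrier X' \<Longrightarrow> w \<in> carrier Y' \<Longrightarrow>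
      F x y z w \<in> carrier P"
  shows "sweedler P s (\<lambda>x y. sweedler P t (F x y))
    = sweedler P t (\<lambda>z w. sweedler P s (\<lambda>x y. F x y z w))"
proof -
  interpret X: module_pair k X Y by (simp add: module_pair.intro assms)
  interpret X': module_pair k X' Y' by (simp add: module_pair.intro assms)
  interpret P: Module.module k P by fact
  show ?thesis
    unfolding sweedler_list_sum
    by (rule P.list_sum_swap[OF X.tensor_repr(1)[OF assms(6)] X'.tensor_repr(1)[OF assms(7)] assms(8)])
qed

text \<open>Coactions and comultiplications alike are linear maps into a tensor product. The locale
  restates the Sweedler rules for sums over \<open>\<rho> x\<close>, so that membership in the
  tensor product follows from \<open>x \<in> carrier X\<close>.\<close>

locale tensor_valued = X: Module.module k X + module_pair k M N
  for k :: "('k, 'x) ring_scheme" and X :: "('k, 'e, 'u) module_scheme"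
    and M :: "('k, 'm, 'y) module_scheme" and N :: "('k, 'n, 'z) module_scheme" +
  fixes \<rho> :: "'e \<Rightarrow> ('m, 'n) tensor"
  assumes linear: "linear_map k X (tensor k M N) \<rho>"
begin

lemma closed: "x \<in> carrier X \<Longrightarrow> \<rho> x \<in> carrier T"
  using linear by (rule linear_map_closed)

lemmas sum_closed = sweedler_closed[OF _ closed]
lemmas sum_cong = sweedler_cong[OF closed]
lemmas map_sum = linear_map_sweedler[OF _ _ _ closed]
lemmas sum_param = sweedler_linear_param[OF _ closed]

lemma sum_linear:
  assumes "Module.module k P" "bilinear_map k M N P F" "linear_map k L X f"
  shows "linear_map k L P (\<lambda>z. sweedler P (\<rho> (f z)) F)"
  using linear_map_compose[OF sweedler_linear[OF assms(1,2)] linear_map_compose[OF linear assms(3)]] .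

lemma sum_sum:
  assumes "Module.module k P" "Module.module k M'" "Module.module k N'"
    and "bilinear_map k M' N' P F" "x \<in> carrier X"
    and "\<And>x y. x \<in> carrier M \<Longrightarrow> y \<in> carrier N \<Longrightarrow> G x y \<in> carrier (tensor k M' N')"
  shows "sweedler P (sweedler (tensor k M' N') (\<rho> x) G) F
    = sweedler P (\<rho> x) (\<lambda>x y. sweedler P (G x y) F)"
  using assms closed M.module_axioms N.module_axioms by (intro sweedler_sweedler)

lemma sum_sum_pure:
  assumes "Module.module k P" "Module.module k M'" "Module.module k N'"
    and "bilinear_map k M' N' P F" "x \<in> carrier X"
    and "\<And>x y. x \<in> carrier M \<Longrightarrow> y \<in> carrier N \<Longrightarrow> G x y \<in> carrier M'"
    and "\<And>x y. x \<in> carrier M \<Longrightarrow> y \<in> carrier N \<Longrightarrow> G' x y \<in> carrier N'"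
  shows "sweedler P (sweedler (tensor k M' N') (\<rho> x) (\<lambda>x y. G x y \<boxtimes>\<^bsub>k,M',N'\<^esub> G' x y)) F
    = sweedler P (\<rho> x) (\<lambda>x y. F (G x y) (G' x y))"
  using assms closed M.module_axioms N.module_axioms by (intro sweedler_sweedler_pure)

end

lemma tensor_valued_swap:
  assumes "tensor_valued k X M N \<rho>" "tensor_valued k X' M' N' \<rho>'"
    and "Module.module k P" "x \<in> carrier X" "x' \<in> carrier X'"
    and "\<And>x y z w. x \<in> carrier M \<Longrightarrow> y \<in> carrier N \<Longrightarrow> z \<in> carrier M' \<Longrightarrow> w \<in> carrier N' \<Longrightarrow>
      F x y z w \<in> carrier P"
  shows "sweedler P (\<rho> x) (\<lambda>x y. sweedler P (\<rho>' x') (F x y))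
    = sweedler P (\<rho>' x') (\<lambda>z w. sweedler P (\<rho> x) (\<lambda>x y. F x y z w))"
proof -
  interpret a: tensor_valued k X M N \<rho> by fact
  interpret b: tensor_valued k X' M' N' \<rho>' by fact
  show ?thesis
    using sweedler_swap[OF a.M.module_axioms a.N.module_axioms b.M.module_axioms b.N.module_axioms
        assms(3) a.closed[OF assms(4)] b.closed[OF assms(5)] assms(6)] .
qed

text \<open>The universal property of the threefold tensor product. The last property admits an
  arbitrary tensor in the second slot because coassociativity has a whole comultiplication there,
  not a pure tensor.\<close>

lemma tensor3_map:
  assumes X: "Module.module k X" and Y: "Module.module k Y" and Z: "Module.module k Z"
    and P: "Module.module k P"
    and F: "\<And>x. x \<in> carrier X \<Longrightarrow> bilinear_map k Y Z P (F x)"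
      "\<And>y z. y \<in> carrier Y \<Longrightarrow> z \<in> carrier Z \<Longrightarrow> linear_map k X P (\<lambda>x. F x y z)"
  obtains L where "linear_map k (tensor k X (tensor k Y Z)) P L"
    "\<And>x y z. x \<in> carrier X \<Longrightarrow> y \<in> carrier Y \<Longrightarrow> z \<in> carrier Z \<Longrightarrow>
      L (x \<boxtimes>\<^bsub>k,X,tensor k Y Z\<^esub> (y \<boxtimes>\<^bsub>k,Y,Z\<^esub> z)) = F x y z"
    "\<And>x s. x \<in> carrier X \<Longrightarrow> s \<in> carrier (tensor k Y Z) \<Longrightarrow>
      L (x \<boxtimes>\<^bsub>k,X,tensor k Y Z\<^esub> s) = sweedler P s (F x)"
proof -
  interpret YZ: module_pair k Y Z by (intro module_pair.intro Y Z)
  interpret X: module_pair k X "tensor k Y Z" by (intro module_pair.intro X YZ.tensor_module)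
  let ?G = "\<lambda>x s. sweedler P s (F x)"
  have b: "bilinear_map k X (tensor k Y Z) P ?G"
  proof (rule bilinear_mapI)
    show "linear_map k (tensor k Y Z) P (?G x)" if "x \<in> carrier X" for x
      by (rule YZ.sweedler_linear[OF P F(1)[OF that]])
    show "linear_map k X P (\<lambda>x. ?G x s)" if "s \<in> carrier (tensor k Y Z)" for s
      by (rule YZ.sweedler_linear_param[OF P that F(2)])
  qed
  show ?thesis
    using that[OF X.sweedler_linear[OF P b]] X.sweedler_pure[OF P b] YZ.sweedler_pure[OF P F(1)]
      YZ.pure_closed by simp
qed

section \<open>Averaging over an integral\<close>

text \<open>The conditions \<open>theta_counit\<close>, \<open>theta_colinear\<close> and \<open>theta_linear\<close> are (ii), (i) and
  (iii) with all automorphisms removed. The maps \<open>\<beta>\<close> and \<open>\<gamma>\<close> only record that everything is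
  equivariant, which makes the averaged map equivariant.\<close>

locale doi_structure =
  rhoA: tensor_valued k A A H \<rho>A + Delta: tensor_valued k C C C \<Delta>
  for k :: "('k, 'x) ring_scheme" and A :: "('k, 'a, 'y) module_scheme"
    and C :: "('k, 'c, 'w) module_scheme" and H :: "('k, 'h, 'z) module_scheme"
    and \<rho>A :: "'a \<Rightarrow> ('a, 'h) tensor" and \<Delta> :: "'c \<Rightarrow> ('c, 'c) tensor" +
  fixes mul :: "'a \<Rightarrow> 'a \<Rightarrow> 'a" and unit :: 'a and \<epsilon> :: "'c \<Rightarrow> 'k"
    and actC :: "'c \<Rightarrow> 'h \<Rightarrow> 'c" and \<theta> :: "'c \<Rightarrow> 'c \<Rightarrow> 'a"
    and \<beta> :: "'a \<Rightarrow> 'a" and \<gamma> :: "'c \<Rightarrow> 'c"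
  assumes mul_bilinear: "bilinear_map k A A A mul"
    and unit_closed: "unit \<in> carrier A"
    and counit_closed: "\<And>c. c \<in> carrier C \<Longrightarrow> \<epsilon> c \<in> carrier k"
    and actC_bilinear: "bilinear_map k C H C actC"
    and theta_bilinear: "bilinear_map k C C A \<theta>"
    and gamma_closed: "\<And>c. c \<in> carrier C \<Longrightarrow> \<gamma> c \<in> carrier C"
    and theta_equivariant: "\<And>c d. c \<in> carrier C \<Longrightarrow> d \<in> carrier C \<Longrightarrow> \<theta> (\<gamma> c) (\<gamma> d) = \<beta> (\<theta> c d)"
    and theta_counit: "\<And>c. c \<in> carrier C \<Longrightarrow> sweedler A (\<Delta> c) \<theta> = \<epsilon> c \<odot>\<^bsub>A\<^esub> unit"
    and theta_colinear: "\<And>c d. c \<in> carrier C \<Longrightarrow> d \<in> carrier C \<Longrightarrow>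
      sweedler (tensor k A C) (\<Delta> c) (\<lambda>c1 c2. \<theta> d c1 \<boxtimes>\<^bsub>k,A,C\<^esub> c2)
      = sweedler (tensor k A C) (\<Delta> d) (\<lambda>d1 d2.
          sweedler (tensor k A C) (\<rho>A (\<theta> d2 c)) (\<lambda>t0 t1. t0 \<boxtimes>\<^bsub>k,A,C\<^esub> actC d1 t1))"
    and theta_linear: "\<And>a c d. a \<in> carrier A \<Longrightarrow> c \<in> carrier C \<Longrightarrow> d \<in> carrier C \<Longrightarrow>
      sweedler A (\<rho>A a) (\<lambda>a0 a1. sweedler A (\<rho>A a0) (\<lambda>a00 a01.
        mul a00 (\<theta> (actC d a01) (actC c a1)))) = mul (\<theta> d c) a"

text \<open>The untwisted objects are classical Doi-Hopf modules; the former twist survives as a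
  linear endomorphism \<open>\<mu>\<close> compatible with action and coaction.\<close>

locale doi_comodule = doi_structure k A C H \<rho>A \<Delta> mul unit \<epsilon> actC \<theta> \<beta> \<gamma> +
  rho: tensor_valued k M M C \<rho>
  for k :: "('k, 'x) ring_scheme" and A :: "('k, 'a, 'y) module_scheme"
    and C :: "('k, 'c, 'w) module_scheme" and H :: "('k, 'h, 'z) module_scheme"
    and \<rho>A :: "'a \<Rightarrow> ('a, 'h) tensor" and \<Delta> :: "'c \<Rightarrow> ('c, 'c) tensor"
    and mul :: "'a \<Rightarrow> 'a \<Rightarrow> 'a" and unit :: 'a and \<epsilon> :: "'c \<Rightarrow> 'k"
    and actC :: "'c \<Rightarrow> 'h \<Rightarrow> 'c" and \<theta> :: "'c \<Rightarrow> 'c \<Rightarrow> 'a"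
    and \<beta> :: "'a \<Rightarrow> 'a" and \<gamma> :: "'c \<Rightarrow> 'c"
    and M :: "('k, 'm, 'v) module_scheme" and \<rho> :: "'m \<Rightarrow> ('m, 'c) tensor" +
  fixes act :: "'m \<Rightarrow> 'a \<Rightarrow> 'm" and \<mu> :: "'m \<Rightarrow> 'm"
  assumes act_bilinear: "bilinear_map k M A M act"
    and act_act: "\<And>m a b. m \<in> carrier M \<Longrightarrow> a \<in> carrier A \<Longrightarrow> b \<in> carrier A \<Longrightarrow>
      act (act m a) b = act m (mul a b)"
    and act_unit: "\<And>m. m \<in> carrier M \<Longrightarrow> act m unit = m"
    and aut_linear: "linear_map k M M \<mu>"
    and act_equivariant: "\<And>m a. m \<in> carrier M \<Longrightarrow> a \<in> carrier A \<Longrightarrow> act (\<mu> m) (\<beta> a) = \<mu> (act m a)"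
    and rho_equivariant: "\<And>m. m \<in> carrier M \<Longrightarrow>
      \<rho> (\<mu> m) = sweedler (tensor k M C) (\<rho> m) (\<lambda>m0 m1. \<mu> m0 \<boxtimes>\<^bsub>k,M,C\<^esub> \<gamma> m1)"
    and rho_coassoc: "\<And>m. m \<in> carrier M \<Longrightarrow>
      sweedler (tensor k M (tensor k C C)) (\<rho> m) (\<lambda>m0 m1.
        sweedler (tensor k M (tensor k C C)) (\<rho> m0) (\<lambda>x y.
          x \<boxtimes>\<^bsub>k,M,tensor k C C\<^esub> (y \<boxtimes>\<^bsub>k,C,C\<^esub> m1)))
      = sweedler (tensor k M (tensor k C C)) (\<rho> m) (\<lambda>m0 m1.
          m0 \<boxtimes>\<^bsub>k,M,tensor k C C\<^esub> \<Delta> m1)"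
    and rho_counit: "\<And>m. m \<in> carrier M \<Longrightarrow> sweedler M (\<rho> m) (\<lambda>m0 m1. \<epsilon> m1 \<odot>\<^bsub>M\<^esub> m0) = m"
    and rho_act: "\<And>m a. m \<in> carrier M \<Longrightarrow> a \<in> carrier A \<Longrightarrow>
      \<rho> (act m a) = sweedler (tensor k M C) (\<rho> m) (\<lambda>m0 m1.
        sweedler (tensor k M C) (\<rho>A a) (\<lambda>a0 a1. act m0 a0 \<boxtimes>\<^bsub>k,M,C\<^esub> actC m1 a1))"
begin

sublocale MT: module_pair k M "tensor k C C"
  by (intro module_pair.intro rho.X.module_axioms Delta.tensor_module)

sublocale AC: module_pair k A C
  by (intro module_pair.intro rhoA.X.module_axioms Delta.X.module_axioms)

lemmas modules = rhoA.X.module_axioms rhoA.N.module_axioms Delta.X.module_axioms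
  rho.X.module_axioms rho.tensor_module Delta.tensor_module MT.tensor_module AC.tensor_module

lemmas closeds = bilinear_map_closed[OF act_bilinear] bilinear_map_closed[OF mul_bilinear]
  bilinear_map_closed[OF actC_bilinear] bilinear_map_closed[OF theta_bilinear]
  rho.closed rhoA.closed Delta.closed unit_closed counit_closed gamma_closed
  linear_map_closed[OF aut_linear]
  rho.sum_closed rhoA.sum_closed Delta.sum_closed
  rho.pure_closed AC.pure_closed MT.pure_closed Delta.pure_closed

text \<open>Linearity of a nested summand in one variable is derived by recursion on its syntax:
  each rule peels off one structure map, and \<open>linear_map_ident\<close> stops at the
  variable.\<close>

lemmas linears = linear_map_ident
  linear_map_bilinear_left[OF act_bilinear] linear_map_bilinear_right[OF act_bilinear]
  linear_map_bilinear_left[OF mul_bilinear] linear_map_bilinear_right[OF mul_bilinear]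
  linear_map_bilinear_left[OF actC_bilinear] linear_map_bilinear_right[OF actC_bilinear]
  linear_map_bilinear_left[OF theta_bilinear] linear_map_bilinear_right[OF theta_bilinear]
  linear_map_bilinear_left[OF rho.pure_bilinear] linear_map_bilinear_right[OF rho.pure_bilinear]
  linear_map_bilinear_left[OF AC.pure_bilinear] linear_map_bilinear_right[OF AC.pure_bilinear]
  linear_map_compose[OF aut_linear]
  rho.sum_linear rho.sum_param rhoA.sum_linear rhoA.sum_param Delta.sum_linear Delta.sum_param

text \<open>Coassociativity is an equation in M \<otimes> (C \<otimes> C). A summand
  \<open>F\<close> that is linear in each variable factors through a linear map there, and applying
  that map to both sides transports the equation to \<open>F\<close>.\<close>

lemma rho_coassoc_sum:
  assumes P: "Module.module k P" and m: "m \<in> carrier M"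
    and F: "\<And>x. x \<in> carrier M \<Longrightarrow> bilinear_map k C C P (F x)"
      "\<And>y z. y \<in> carrier C \<Longrightarrow> z \<in> carrier C \<Longrightarrow> linear_map k M P (\<lambda>x. F x y z)"
  shows "sweedler P (\<rho> m) (\<lambda>m0 m1. sweedler P (\<rho> m0) (\<lambda>x y. F x y m1))
    = sweedler P (\<rho> m) (\<lambda>m0 m1. sweedler P (\<Delta> m1) (F m0))"
proof -
  obtain L where L: "linear_map k MT.T P L"
    "\<And>x y z. x \<in> carrier M \<Longrightarrow> y \<in> carrier C \<Longrightarrow> z \<in> carrier C \<Longrightarrow>
      L (x \<boxtimes>\<^bsub>k,M,tensor k C C\<^esub> (y \<boxtimes>\<^bsub>k,C,C\<^esub> z)) = F x y z"
    "\<And>x s. x \<in> carrier M \<Longrightarrow> s \<in> carrier (tensor k C C) \<Longrightarrow>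
      L (x \<boxtimes>\<^bsub>k,M,tensor k C C\<^esub> s) = sweedler P s (F x)"
    by (rule tensor3_map[OF rho.X.module_axioms Delta.X.module_axioms Delta.X.module_axioms P F])
      blast+
  note map_sum = rho.map_sum[OF MT.tensor_module P L(1)]
  have "sweedler P (\<rho> m) (\<lambda>m0 m1. sweedler P (\<rho> m0) (\<lambda>x y. F x y m1))
    = L (sweedler MT.T (\<rho> m) (\<lambda>m0 m1. sweedler MT.T (\<rho> m0) (\<lambda>x y.
          x \<boxtimes>\<^bsub>k,M,tensor k C C\<^esub> (y \<boxtimes>\<^bsub>k,C,C\<^esub> m1))))"
    by (auto simp: m map_sum L(2) closeds modules intro!: rho.sum_cong)
  also have "\<dots> = sweedler P (\<rho> m) (\<lambda>m0 m1. sweedler P (\<Delta> m1) (F m0))"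
    by (auto simp: m map_sum L(3) rho_coassoc closeds modules intro!: rho.sum_cong)
  finally show ?thesis .
qed

text \<open>The retraction of the coaction supplied by \<theta>, as a function of the two factors of
  M \<otimes> C.\<close>

definition avg :: "'m \<Rightarrow> 'c \<Rightarrow> 'm" where
  "avg m c = sweedler M (\<rho> m) (\<lambda>x y. act x (\<theta> y c))"

lemma avg_bilinear: "bilinear_map k M C M avg"
  unfolding avg_def by (intro bilinear_mapI linears modules) (simp_all add: closeds)

lemma avg_closed: "m \<in> carrier M \<Longrightarrow> c \<in> carrier C \<Longrightarrow> avg m c \<in> carrier M"
  using bilinear_map_closed[OF avg_bilinear] .

lemma avg_equivariant:
  assumes "m \<in> carrier M" "c \<in> carrier C"
  shows "avg (\<mu> m) (\<gamma> c) = \<mu> (avg m c)"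
proof -
  have "avg (\<mu> m) (\<gamma> c) = sweedler M (\<rho> m) (\<lambda>x y. act (\<mu> x) (\<theta> (\<gamma> y) (\<gamma> c)))"
    unfolding avg_def rho_equivariant[OF assms(1)]
    by (intro rho.sum_sum_pure bilinear_mapI linears modules) (simp_all add: assms closeds)
  also have "\<dots> = sweedler M (\<rho> m) (\<lambda>x y. \<mu> (act x (\<theta> y c)))"
    by (intro rho.sum_cong) (simp_all add: assms closeds theta_equivariant act_equivariant)
  also have "\<dots> = \<mu> (avg m c)"
    unfolding avg_def
    by (intro rho.map_sum[symmetric] aut_linear modules) (simp_all add: assms closeds)
  finally show ?thesis .
qed

text \<open>The point where normalization enters: it makes \<open>avg\<close> a retraction of the
  coaction.\<close>

lemma avg_self:
  assumes m: "m \<in> carrier M"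
  shows "sweedler M (\<rho> m) avg = m"
proof -
  have "sweedler M (\<rho> m) avg = sweedler M (\<rho> m) (\<lambda>m0 m1. sweedler M (\<Delta> m1) (\<lambda>y z. act m0 (\<theta> y z)))"
    unfolding avg_def
    by (rule rho_coassoc_sum) (auto simp: m closeds intro!: bilinear_mapI linears modules)
  also have "\<dots> = sweedler M (\<rho> m) (\<lambda>m0 m1. \<epsilon> m1 \<odot>\<^bsub>M\<^esub> m0)"
  proof (rule rho.sum_cong[OF m])
    fix m0 m1 assume *: "m0 \<in> carrier M" "m1 \<in> carrier C"
    have "sweedler M (\<Delta> m1) (\<lambda>y z. act m0 (\<theta> y z)) = act m0 (sweedler A (\<Delta> m1) \<theta>)"
      by (intro Delta.map_sum[symmetric] linears modules bilinear_map_right[OF act_bilinear])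
        (simp_all add: * closeds)
    then show "sweedler M (\<Delta> m1) (\<lambda>y z. act m0 (\<theta> y z)) = \<epsilon> m1 \<odot>\<^bsub>M\<^esub> m0"
      using * linear_map_smult[OF bilinear_map_right[OF act_bilinear]]
      by (simp add: theta_counit closeds act_unit)
  qed
  finally show ?thesis using rho_counit m by simp
qed

text \<open>Linearity for the diagonal action on M \<otimes> C. Coacting on \<open>act m a0\<close>
  splits \<open>a0\<close> further, so \<open>a\<close> appears in the three pieces a_00, a_01, a_1,
  which is the pattern of \<open>theta_linear\<close>.\<close>

lemma avg_act:
  assumes m: "m \<in> carrier M" and a: "a \<in> carrier A" and c: "c \<in> carrier C"
  shows "sweedler M (\<rho>A a) (\<lambda>a0 a1. avg (act m a0) (actC c a1)) = act (avg m c) a"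
proof -
  let ?th = "\<lambda>y a00 a01 a1. mul a00 (\<theta> (actC y a01) (actC c a1))"
  have 1: "avg (act m b) d = sweedler M (\<rho> m) (\<lambda>x y. sweedler M (\<rho>A b) (\<lambda>b0 b1.
      act x (mul b0 (\<theta> (actC y b1) d))))" if "b \<in> carrier A" "d \<in> carrier C" for b d
  proof -
    have "avg (act m b) d = sweedler M (\<rho> m) (\<lambda>x y. sweedler M
        (sweedler (tensor k M C) (\<rho>A b) (\<lambda>a0 a1. act x a0 \<boxtimes>\<^bsub>k,M,C\<^esub> actC y a1))
        (\<lambda>x y. act x (\<theta> y d)))"
      unfolding avg_def rho_act[OF m that(1)]
      by (intro rho.sum_sum bilinear_mapI linears modules) (simp_all add: m that closeds modules)
    also have "\<dots> = sweedler M (\<rho> m) (\<lambda>x y. sweedler M (\<rho>A b) (\<lambda>b0 b1.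
        act (act x b0) (\<theta> (actC y b1) d)))"
      by (intro rho.sum_cong rhoA.sum_sum_pure bilinear_mapI linears modules)
        (simp_all add: m that closeds)
    also have "\<dots> = sweedler M (\<rho> m) (\<lambda>x y. sweedler M (\<rho>A b) (\<lambda>b0 b1.
        act x (mul b0 (\<theta> (actC y b1) d))))"
      by (intro rho.sum_cong rhoA.sum_cong) (simp_all add: m that closeds act_act)
    finally show ?thesis .
  qed
  have "sweedler M (\<rho>A a) (\<lambda>a0 a1. avg (act m a0) (actC c a1))
    = sweedler M (\<rho>A a) (\<lambda>a0 a1. sweedler M (\<rho> m) (\<lambda>x y. sweedler M (\<rho>A a0) (\<lambda>b0 b1.
      act x (?th y b0 b1 a1))))"
    by (intro rhoA.sum_cong a 1) (simp_all add: c closeds)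
  \<comment> \<open>The coactions on \<open>a\<close> and on \<open>m\<close> are independent.
    Exchanging them leaves, for fixed \<open>x\<close> and \<open>y\<close>, a double sum over the
    pieces of \<open>a\<close>, to which \<open>theta_linear\<close> applies once
    \<open>act x\<close> is taken out.\<close>
  also have "\<dots> = sweedler M (\<rho> m) (\<lambda>x y. sweedler M (\<rho>A a) (\<lambda>a0 a1. sweedler M (\<rho>A a0) (\<lambda>b0 b1.
      act x (?th y b0 b1 a1))))"
    by (rule tensor_valued_swap[OF rhoA.tensor_valued_axioms rho.tensor_valued_axioms])
      (simp_all add: a m c closeds modules)
  also have "\<dots> = sweedler M (\<rho> m) (\<lambda>x y. act (act x (\<theta> y c)) a)"
  proof (rule rho.sum_cong[OF m])
    fix x y assume *: "x \<in> carrier M" "y \<in> carrier C"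
    note lin = bilinear_map_right[OF act_bilinear *(1)]
    have "sweedler M (\<rho>A a) (\<lambda>a0 a1. sweedler M (\<rho>A a0) (\<lambda>b0 b1. act x (?th y b0 b1 a1)))
      = sweedler M (\<rho>A a) (\<lambda>a0 a1. act x (sweedler A (\<rho>A a0) (\<lambda>b0 b1. ?th y b0 b1 a1)))"
      by (intro rhoA.sum_cong a rhoA.map_sum[symmetric] lin modules) (simp_all add: a c * closeds)
    also have "\<dots> = act x (sweedler A (\<rho>A a) (\<lambda>a0 a1. sweedler A (\<rho>A a0) (\<lambda>b0 b1. ?th y b0 b1 a1)))"
      by (intro a rhoA.map_sum[symmetric] lin modules) (simp_all add: a c * closeds modules)
    finally show "sweedler M (\<rho>A a) (\<lambda>a0 a1. sweedler M (\<rho>A a0) (\<lambda>b0 b1. act x (?th y b0 b1 a1)))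
      = act (act x (\<theta> y c)) a"
      by (simp add: theta_linear act_act a c * closeds)
  qed
  also have "\<dots> = act (avg m c) a"
    unfolding avg_def
    by (intro m rho.map_sum[symmetric] bilinear_map_left[OF act_bilinear] modules)
      (simp_all add: a c closeds)
  finally show ?thesis .
qed

text \<open>Colinearity for the coaction on the second factor of M \<otimes> C. Coacting on m_0
  \<theta>(m_1 \<otimes> c) coacts on m_0 again; coassociativity turns this into \<Delta>(m_1), and
  the result contains the right side of \<open>theta_colinear\<close> with m_1 in the place of
  \<open>d\<close>.\<close>

lemma rho_avg:
  assumes m: "m \<in> carrier M" and c: "c \<in> carrier C"
  shows "\<rho> (avg m c) = sweedler (tensor k M C) (\<Delta> c) (\<lambda>c1 c2. avg m c1 \<boxtimes>\<^bsub>k,M,C\<^esub> c2)"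
proof -
  let ?T = "tensor k M C" and ?S = "tensor k A C"
  let ?L = "\<lambda>x s. sweedler ?T s (\<lambda>t d. act x t \<boxtimes>\<^bsub>k,M,C\<^esub> d)"
  have b: "bilinear_map k A C ?T (\<lambda>t d. act x t \<boxtimes>\<^bsub>k,M,C\<^esub> d)" if "x \<in> carrier M" for x
    by (intro bilinear_mapI linears modules) (simp_all add: that closeds)
  have "\<rho> (avg m c) = sweedler ?T (\<rho> m) (\<lambda>x y. \<rho> (act x (\<theta> y c)))"
    unfolding avg_def
    by (intro rho.map_sum rho.linear modules) (simp_all add: m c closeds)
  also have "\<dots> = sweedler ?T (\<rho> m) (\<lambda>x y. sweedler ?T (\<rho> x) (\<lambda>x0 x1.
      sweedler ?T (\<rho>A (\<theta> y c)) (\<lambda>t0 t1. act x0 t0 \<boxtimes>\<^bsub>k,M,C\<^esub> actC x1 t1)))"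
    by (intro rho.sum_cong rho_act) (simp_all add: m c closeds)
  also have "\<dots> = sweedler ?T (\<rho> m) (\<lambda>x y. sweedler ?T (\<Delta> y) (\<lambda>y1 y2.
      sweedler ?T (\<rho>A (\<theta> y2 c)) (\<lambda>t0 t1. act x t0 \<boxtimes>\<^bsub>k,M,C\<^esub> actC y1 t1)))"
    by (rule rho_coassoc_sum) (auto simp: m c closeds intro!: bilinear_mapI linears modules)
  \<comment> \<open>The equation \<open>theta_colinear\<close> lives in A \<otimes> C, so
    \<open>x\<close> is pulled out as the linear map \<open>?L x\<close>, which sends t \<otimes> d
    to x t \<otimes> d.\<close>
  also have "\<dots> = sweedler ?T (\<rho> m) (\<lambda>x y. ?L x (sweedler ?S (\<Delta> y) (\<lambda>y1 y2.
      sweedler ?S (\<rho>A (\<theta> y2 c)) (\<lambda>t0 t1. t0 \<boxtimes>\<^bsub>k,A,C\<^esub> actC y1 t1))))"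
  proof (rule rho.sum_cong[OF m])
    fix x y assume *: "x \<in> carrier M" "y \<in> carrier C"
    show "sweedler ?T (\<Delta> y) (\<lambda>y1 y2. sweedler ?T (\<rho>A (\<theta> y2 c)) (\<lambda>t0 t1. act x t0 \<boxtimes>\<^bsub>k,M,C\<^esub> actC y1 t1))
      = ?L x (sweedler ?S (\<Delta> y) (\<lambda>y1 y2. sweedler ?S (\<rho>A (\<theta> y2 c)) (\<lambda>t0 t1. t0 \<boxtimes>\<^bsub>k,A,C\<^esub> actC y1 t1)))"
      by (subst Delta.sum_sum[OF _ _ _ b[OF *(1)] *(2)])
        (auto simp: * c closeds modules rhoA.sum_sum_pure b intro!: Delta.sum_cong)
  qed
  also have "\<dots> = sweedler ?T (\<rho> m) (\<lambda>x y. ?L x (sweedler ?S (\<Delta> c) (\<lambda>c1 c2.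
      \<theta> y c1 \<boxtimes>\<^bsub>k,A,C\<^esub> c2)))"
    by (intro rho.sum_cong) (simp_all add: m c theta_colinear)
  also have "\<dots> = sweedler ?T (\<rho> m) (\<lambda>x y. sweedler ?T (\<Delta> c) (\<lambda>c1 c2.
      act x (\<theta> y c1) \<boxtimes>\<^bsub>k,M,C\<^esub> c2))"
  proof (rule rho.sum_cong[OF m])
    fix x y assume *: "x \<in> carrier M" "y \<in> carrier C"
    show "?L x (sweedler ?S (\<Delta> c) (\<lambda>c1 c2. \<theta> y c1 \<boxtimes>\<^bsub>k,A,C\<^esub> c2))
      = sweedler ?T (\<Delta> c) (\<lambda>c1 c2. act x (\<theta> y c1) \<boxtimes>\<^bsub>k,M,C\<^esub> c2)"
      by (rule Delta.sum_sum_pure) (simp_all add: * c b closeds modules)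
  qed
  also have "\<dots> = sweedler ?T (\<Delta> c) (\<lambda>c1 c2. sweedler ?T (\<rho> m) (\<lambda>x y.
      act x (\<theta> y c1) \<boxtimes>\<^bsub>k,M,C\<^esub> c2))"
    by (rule tensor_valued_swap[OF rho.tensor_valued_axioms Delta.tensor_valued_axioms])
      (simp_all add: m c closeds modules)
  also have "\<dots> = sweedler ?T (\<Delta> c) (\<lambda>c1 c2. avg m c1 \<boxtimes>\<^bsub>k,M,C\<^esub> c2)"
    unfolding avg_def
    by (intro Delta.sum_cong c rho.map_sum[symmetric] bilinear_map_left[OF rho.pure_bilinear] modules)
      (simp_all add: m c closeds)
  finally show ?thesis .
qed

end

section \<open>The averaged morphism\<close>

locale doi_averaging =
  N: doi_comodule k A C H \<rho>A \<Delta> mul unit \<epsilon> actC \<theta> \<beta> \<gamma> N \<rho>N actN \<nu> +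
  M: doi_comodule k A C H \<rho>A \<Delta> mul unit \<epsilon> actC \<theta> \<beta> \<gamma> M \<rho>M actM \<mu>
  for k :: "('k, 'x) ring_scheme" and A :: "('k, 'a, 'y) module_scheme"
    and C :: "('k, 'c, 'w) module_scheme" and H :: "('k, 'h, 'z) module_scheme"
    and \<rho>A :: "'a \<Rightarrow> ('a, 'h) tensor" and \<Delta> :: "'c \<Rightarrow> ('c, 'c) tensor"
    and mul :: "'a \<Rightarrow> 'a \<Rightarrow> 'a" and unit :: 'a and \<epsilon> :: "'c \<Rightarrow> 'k"
    and actC :: "'c \<Rightarrow> 'h \<Rightarrow> 'c" and \<theta> :: "'c \<Rightarrow> 'c \<Rightarrow> 'a"
    and \<beta> :: "'a \<Rightarrow> 'a" and \<gamma> :: "'c \<Rightarrow> 'c"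
    and N :: "('k, 'n, 'v) module_scheme" and \<rho>N :: "'n \<Rightarrow> ('n, 'c) tensor"
    and actN :: "'n \<Rightarrow> 'a \<Rightarrow> 'n" and \<nu> :: "'n \<Rightarrow> 'n"
    and M :: "('k, 'm, 'u) module_scheme" and \<rho>M :: "'m \<Rightarrow> ('m, 'c) tensor"
    and actM :: "'m \<Rightarrow> 'a \<Rightarrow> 'm" and \<mu> :: "'m \<Rightarrow> 'm" +
  fixes g :: "'n \<Rightarrow> 'm"
  assumes g_linear: "linear_map k N M g"
    and g_equivariant: "\<And>n. n \<in> carrier N \<Longrightarrow> g (\<nu> n) = \<mu> (g n)"
    and g_act: "\<And>n a. n \<in> carrier N \<Longrightarrow> a \<in> carrier A \<Longrightarrow> g (actN n a) = actM (g n) a"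
begin

text \<open>The composite N \<rightarrow> N \<otimes> C \<rightarrow> M \<otimes> C \<rightarrow> M
  of the coaction, of \<open>g\<close> on the first factor, and of \<open>M.avg\<close>. The outer
  two arrows respect action and coaction, and the middle one does so as soon as \<open>g\<close> is
  linear over A.\<close>

definition averaged :: "'n \<Rightarrow> 'm" where
  "averaged n = sweedler M (\<rho>N n) (\<lambda>n0 n1. M.avg (g n0) n1)"

lemmas closeds = N.closeds M.closeds M.avg_closed linear_map_closed[OF g_linear]
lemmas modules = N.modules M.modules

lemma avg_g_bilinear: "bilinear_map k N C M (\<lambda>n0 n1. M.avg (g n0) n1)"
  by (intro bilinear_mapI linear_map_bilinear_left[OF M.avg_bilinear] g_linear
      bilinear_map_right[OF M.avg_bilinear]) (simp_all add: closeds)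

lemma averaged_linear: "linear_map k N M averaged"
  unfolding averaged_def by (intro N.rho.sum_linear modules avg_g_bilinear linear_map_ident)

lemma averaged_equivariant:
  assumes n: "n \<in> carrier N"
  shows "averaged (\<nu> n) = \<mu> (averaged n)"
proof -
  have "averaged (\<nu> n) = sweedler M (\<rho>N n) (\<lambda>n0 n1. M.avg (g (\<nu> n0)) (\<gamma> n1))"
    unfolding averaged_def N.rho_equivariant[OF n]
    by (intro N.rho.sum_sum_pure modules avg_g_bilinear) (simp_all add: n closeds)
  also have "\<dots> = sweedler M (\<rho>N n) (\<lambda>n0 n1. \<mu> (M.avg (g n0) n1))"
    by (intro N.rho.sum_cong n) (simp add: g_equivariant M.avg_equivariant closeds)
  also have "\<dots> = \<mu> (averaged n)"
    unfolding averaged_def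
    by (intro N.rho.map_sum[symmetric] modules M.aut_linear n) (simp add: closeds)
  finally show ?thesis .
qed

lemma averaged_act:
  assumes n: "n \<in> carrier N" and a: "a \<in> carrier A"
  shows "averaged (actN n a) = actM (averaged n) a"
proof -
  have "averaged (actN n a) = sweedler M (\<rho>N n) (\<lambda>n0 n1. sweedler M
      (sweedler (tensor k N C) (\<rho>A a) (\<lambda>a0 a1. actN n0 a0 \<boxtimes>\<^bsub>k,N,C\<^esub> actC n1 a1))
      (\<lambda>n0 n1. M.avg (g n0) n1))"
    unfolding averaged_def N.rho_act[OF n a]
    by (intro N.rho.sum_sum modules avg_g_bilinear) (simp_all add: n a closeds modules)
  also have "\<dots> = sweedler M (\<rho>N n) (\<lambda>n0 n1. sweedler M (\<rho>A a) (\<lambda>a0 a1.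
      M.avg (g (actN n0 a0)) (actC n1 a1)))"
    by (intro N.rho.sum_cong N.rhoA.sum_sum_pure n a modules avg_g_bilinear) (simp_all add: closeds)
  also have "\<dots> = sweedler M (\<rho>N n) (\<lambda>n0 n1. sweedler M (\<rho>A a) (\<lambda>a0 a1.
      M.avg (actM (g n0) a0) (actC n1 a1)))"
    by (intro N.rho.sum_cong N.rhoA.sum_cong n a) (simp add: g_act)
  also have "\<dots> = sweedler M (\<rho>N n) (\<lambda>n0 n1. actM (M.avg (g n0) n1) a)"
    by (intro N.rho.sum_cong n) (simp add: a M.avg_act closeds)
  also have "\<dots> = actM (averaged n) a"
    unfolding averaged_def
    by (intro N.rho.map_sum[symmetric] modules bilinear_map_left[OF M.act_bilinear] n a)
      (simp add: closeds)
  finally show ?thesis .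
qed

lemma rho_averaged:
  assumes n: "n \<in> carrier N"
  shows "\<rho>M (averaged n) = sweedler (tensor k M C) (\<rho>N n) (\<lambda>n0 n1. averaged n0 \<boxtimes>\<^bsub>k,M,C\<^esub> n1)"
proof -
  let ?T = "tensor k M C"
  have "\<rho>M (averaged n) = sweedler ?T (\<rho>N n) (\<lambda>n0 n1. \<rho>M (M.avg (g n0) n1))"
    unfolding averaged_def
    by (intro N.rho.map_sum modules M.rho.linear n) (simp add: closeds)
  also have "\<dots> = sweedler ?T (\<rho>N n) (\<lambda>n0 n1. sweedler ?T (\<Delta> n1) (\<lambda>c1 c2.
      M.avg (g n0) c1 \<boxtimes>\<^bsub>k,M,C\<^esub> c2))"
    by (intro N.rho.sum_cong n) (simp add: M.rho_avg closeds)
  \<comment> \<open>Coassociativity of N read backwards: the comultiplication of \<open>n1\<close>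
    becomes a second coaction on \<open>n0\<close>, and the inner sum is then the average of
    \<open>n0\<close>.\<close>
  also have "\<dots> = sweedler ?T (\<rho>N n) (\<lambda>n0 n1. sweedler ?T (\<rho>N n0) (\<lambda>x y.
      M.avg (g x) y \<boxtimes>\<^bsub>k,M,C\<^esub> n1))"
    by (rule N.rho_coassoc_sum[symmetric]) (auto simp: n closeds
        intro!: modules bilinear_mapI M.linears linear_map_bilinear_left[OF M.avg_bilinear] g_linear
          linear_map_bilinear_right[OF M.avg_bilinear])
  also have "\<dots> = sweedler ?T (\<rho>N n) (\<lambda>n0 n1. averaged n0 \<boxtimes>\<^bsub>k,M,C\<^esub> n1)"
    unfolding averaged_def
    by (intro N.rho.sum_cong N.rho.map_sum[symmetric] n modules
        bilinear_map_left[OF M.rho.pure_bilinear]) (simp_all add: closeds)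
  finally show ?thesis .
qed

text \<open>Colinearity of \<open>f\<close> carries the coaction from \<open>f m\<close> back to
  \<open>m\<close>; there \<open>g\<close> undoes \<open>f\<close> under the sum, and
  \<open>M.avg\<close> retracts the coaction of M.\<close>

lemma averaged_retraction:
  assumes f: "linear_map k M N f" and m: "m \<in> carrier M"
    and f_colinear: "\<rho>N (f m) = sweedler (tensor k N C) (\<rho>M m) (\<lambda>m0 m1. f m0 \<boxtimes>\<^bsub>k,N,C\<^esub> m1)"
    and gf: "\<And>x. x \<in> carrier M \<Longrightarrow> g (f x) = x"
  shows "averaged (f m) = m"
proof -
  have "averaged (f m) = sweedler M (\<rho>M m) (\<lambda>m0 m1. M.avg (g (f m0)) m1)"
    unfolding averaged_def f_colinear
    by (intro M.rho.sum_sum_pure modules avg_g_bilinear m) (simp_all add: linear_map_closed[OF f])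
  also have "\<dots> = sweedler M (\<rho>M m) M.avg"
    by (intro M.rho.sum_cong m) (simp add: gf)
  finally show ?thesis by (simp add: M.avg_self m)
qed

lemma averaged_section:
  assumes f: "linear_map k M N f" and n: "n \<in> carrier N"
    and f_act: "\<And>x a. x \<in> carrier M \<Longrightarrow> a \<in> carrier A \<Longrightarrow> f (actM x a) = actN (f x) a"
    and f_colinear: "\<And>x. x \<in> carrier M \<Longrightarrow>
      \<rho>N (f x) = sweedler (tensor k N C) (\<rho>M x) (\<lambda>m0 m1. f m0 \<boxtimes>\<^bsub>k,N,C\<^esub> m1)"
    and fg: "\<And>y. y \<in> carrier N \<Longrightarrow> f (g y) = y"
  shows "f (averaged n) = n"
proof -
  note f_closed = linear_map_closed[OF f]
  \<comment> \<open>Naturality of the retraction: \<open>f\<close> passes through the action by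
    linearity and through the coaction by colinearity. Once moved inside, it meets \<open>g\<close>
    and cancels.\<close>
  have f_avg: "f (M.avg x c) = N.avg (f x) c" if "x \<in> carrier M" "c \<in> carrier C" for x c
  proof -
    have "f (M.avg x c) = sweedler N (\<rho>M x) (\<lambda>y z. f (actM y (\<theta> z c)))"
      unfolding M.avg_def by (intro M.rho.map_sum modules f that) (simp add: that closeds)
    also have "\<dots> = sweedler N (\<rho>M x) (\<lambda>y z. actN (f y) (\<theta> z c))"
      by (intro M.rho.sum_cong that f_act) (simp_all add: that closeds)
    also have "\<dots> = N.avg (f x) c"
      unfolding N.avg_def f_colinear[OF that(1)]
      by (intro M.rho.sum_sum_pure[symmetric] modules that bilinear_mapI N.linears)
        (simp_all add: that closeds f_closed)
    finally show ?thesis .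
  qed
  have "f (averaged n) = sweedler N (\<rho>N n) (\<lambda>n0 n1. f (M.avg (g n0) n1))"
    unfolding averaged_def by (intro N.rho.map_sum modules f n) (simp add: closeds)
  also have "\<dots> = sweedler N (\<rho>N n) N.avg"
    by (intro N.rho.sum_cong n) (simp add: f_avg fg closeds)
  finally show ?thesis by (simp add: N.avg_self n)
qed

end

section \<open>Untwisting Hom-structures\<close>

context hom_object
begin

lemma aut_closed: "x \<in> carrier M \<Longrightarrow> aut M x \<in> carrier M"
  using aut_linear by (rule linear_map_closed)

lemma aut_inv_closed: "x \<in> carrier M \<Longrightarrow> aut_inv M x \<in> carrier M"
  unfolding aut_inv_def using aut_bij by (metis bij_betw_def inv_into_into)

lemma aut_aut_inv: "x \<in> carrier M \<Longrightarrow> aut M (aut_inv M x) = x"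
  unfolding aut_inv_def using aut_bij by (rule bij_betw_inv_into_right)

lemma aut_inv_aut: "x \<in> carrier M \<Longrightarrow> aut_inv M (aut M x) = x"
  unfolding aut_inv_def using aut_bij by (rule bij_betw_inv_into_left)

lemma aut_inv_linear: "linear_map k M M (aut_inv M)"
proof (rule linear_mapI)
  fix x y assume "x \<in> carrier M" "y \<in> carrier M"
  then have "aut_inv M (aut M (aut_inv M x) \<oplus>\<^bsub>M\<^esub> aut M (aut_inv M y)) = aut_inv M x \<oplus>\<^bsub>M\<^esub> aut_inv M y"
    using linear_map_add[OF aut_linear, symmetric] by (simp add: aut_inv_closed aut_inv_aut)
  then show "aut_inv M (x \<oplus>\<^bsub>M\<^esub> y) = aut_inv M x \<oplus>\<^bsub>M\<^esub> aut_inv M y"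
    using \<open>x \<in> _\<close> \<open>y \<in> _\<close> by (simp add: aut_aut_inv)
next
  fix r x assume "r \<in> carrier k" "x \<in> carrier M"
  then have "aut_inv M (r \<odot>\<^bsub>M\<^esub> aut M (aut_inv M x)) = r \<odot>\<^bsub>M\<^esub> aut_inv M x"
    using linear_map_smult[OF aut_linear, symmetric] by (simp add: aut_inv_closed aut_inv_aut)
  then show "aut_inv M (r \<odot>\<^bsub>M\<^esub> x) = r \<odot>\<^bsub>M\<^esub> aut_inv M x"
    using \<open>x \<in> _\<close> by (simp add: aut_aut_inv)
qed (rule aut_inv_closed)

end

lemma (in module_pair) bilinear_map_pure:
  assumes "linear_map k (tensor k M N) P f"
  shows "bilinear_map k M N P (\<lambda>x y. f (x \<boxtimes>\<^bsub>k,M,N\<^esub> y))"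
  by (intro bilinear_mapI linear_map_compose[OF assms] bilinear_map_left[OF pure_bilinear]
      bilinear_map_right[OF pure_bilinear])

text \<open>The same formula serves for the action on a module, for the multiplication of A and for
  the action of H on C.\<close>

definition untwist ::
  "('k, 'x) ring_scheme \<Rightarrow> ('k, 'm, 'y) hom_object_scheme \<Rightarrow> ('k, 'a, 'z) module_scheme
    \<Rightarrow> (('m, 'a) tensor \<Rightarrow> 'm) \<Rightarrow> 'm \<Rightarrow> 'a \<Rightarrow> 'm" where
  "untwist k M A act m a = aut_inv M (act (m \<boxtimes>\<^bsub>k,M,A\<^esub> a))"

context hom_module
begin

sublocale MA: module_pair k M A
  by (intro module_pair.intro obj.module_axioms alg.module_axioms)

lemma act_closed: "m \<in> carrier M \<Longrightarrow> a \<in> carrier A \<Longrightarrow> act (m \<boxtimes>\<^bsub>k,M,A\<^esub> a) \<in> carrier M"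
  by (intro linear_map_closed[OF act_linear] MA.pure_closed)

lemma untwist_bilinear: "bilinear_map k M A M (untwist k M A act)"
  using MA.bilinear_map_pure[OF linear_map_compose[OF obj.aut_inv_linear act_linear]]
  unfolding untwist_def .

lemmas untwist_closed = bilinear_map_closed[OF untwist_bilinear]

lemma aut_untwist: "m \<in> carrier M \<Longrightarrow> a \<in> carrier A \<Longrightarrow>
    aut M (untwist k M A act m a) = act (m \<boxtimes>\<^bsub>k,M,A\<^esub> a)"
  by (simp add: untwist_def obj.aut_aut_inv act_closed)

text \<open>The automorphisms respect the action, so they combine into one that the inverse inside
  \<open>untwist\<close> cancels. Read backwards, the rule expresses a Hom-product as an untwisted
  product of shifted arguments.\<close>

lemma untwist_aut_aut: "m \<in> carrier M \<Longrightarrow> a \<in> carrier A \<Longrightarrow>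
    untwist k M A act (aut M m) (aut A a) = act (m \<boxtimes>\<^bsub>k,M,A\<^esub> a)"
  by (simp add: untwist_def aut_act[symmetric] obj.aut_inv_aut act_closed)

lemma untwist_unit: "m \<in> carrier M \<Longrightarrow> untwist k M A act m unit = m"
  by (simp add: untwist_def act_unit obj.aut_inv_aut)

end

text \<open>Through this, facts on untwisted actions apply to the multiplication as well.\<close>

lemma (in hom_algebra) hom_module_self: "hom_module k A mul unit A mul"
  by unfold_locales (simp_all add: mul_linear aut_mul hom_assoc right_unit)

text \<open>Two applications of \<open>aut M\<close> turn the claim into Hom-associativity, (m
  \<cdot> a) \<cdot> \<beta>(b) = \<mu>(m) \<cdot> (a b); injectivity then removes them.\<close>

lemma (in hom_module) untwist_untwist:
  assumes "m \<in> carrier M" "a \<in> carrier A" "b \<in> carrier A"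
  shows "untwist k M A act (untwist k M A act m a) b = untwist k M A act m (untwist k A A mul a b)"
proof -
  interpret A: hom_module k A mul unit A mul by (rule alg.hom_module_self)
  have "aut M (aut M (untwist k M A act (untwist k M A act m a) b))
    = act (act (m \<boxtimes>\<^bsub>k,M,A\<^esub> a) \<boxtimes>\<^bsub>k,M,A\<^esub> aut A b)"
    using assms by (simp add: aut_untwist untwist_closed aut_act)
  also have "\<dots> = aut M (aut M (untwist k M A act m (untwist k A A mul a b)))"
    using assms by (simp add: aut_untwist A.aut_untwist A.untwist_closed untwist_closed aut_act act_act)
  finally show ?thesis
    using assms obj.aut_bij by (simp add: bij_betw_def inj_on_def untwist_closed A.untwist_closed
        obj.aut_closed)
qed

section \<open>Untwisted comultiplication and coaction\<close>

context hom_coalgebra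
begin

sublocale comul: tensor_valued k C C C comul
  by unfold_locales (rule comul_linear)

lemma comul_aut_sum:
  assumes "Module.module k P" "bilinear_map k C C P F" "c \<in> carrier C"
  shows "sweedler P (comul (aut C c)) F = sweedler P (comul c) (\<lambda>x y. F (aut C x) (aut C y))"
  unfolding comul_aut[OF assms(3)]
  by (intro comul.sum_sum_pure assms module_axioms aut_closed)

end

context hom_comodule
begin

sublocale coact: tensor_valued k M M C coact
  by unfold_locales (rule coact_linear)

lemma coact_aut_sum:
  assumes "Module.module k P" "bilinear_map k M C P F" "m \<in> carrier M"
  shows "sweedler P (coact (aut M m)) F = sweedler P (coact m) (\<lambda>x y. F (aut M x) (aut C y))"
  unfolding coact_aut[OF assms(3)]
  by (intro coact.sum_sum_pure assms obj.module_axioms coalg.module_axioms obj.aut_closed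
      coalg.aut_closed)

lemma untwisted_tensor_valued: "tensor_valued k M M C (\<lambda>m. coact (aut M m))"
  by unfold_locales (rule linear_map_compose[OF coact_linear obj.aut_linear])

text \<open>Hom-coassociativity is used at \<mu>(\<mu>(m)). The outer automorphism is distributed
  over the factors of the coaction; there it cancels the inverses of \<gamma> and \<mu> in the axiom
  and supplies the inner shifts of the claim.\<close>

lemma untwisted_coassoc:
  assumes m: "m \<in> carrier M"
  shows "sweedler (tensor k M (tensor k C C)) (coact (aut M m)) (\<lambda>m0 m1.
      sweedler (tensor k M (tensor k C C)) (coact (aut M m0)) (\<lambda>x y.
        x \<boxtimes>\<^bsub>k,M,tensor k C C\<^esub> (y \<boxtimes>\<^bsub>k,C,C\<^esub> m1)))
    = sweedler (tensor k M (tensor k C C)) (coact (aut M m)) (\<lambda>m0 m1.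
        m0 \<boxtimes>\<^bsub>k,M,tensor k C C\<^esub> comul (aut C m1))"
proof -
  interpret T: module_pair k M "tensor k C C"
    by (intro module_pair.intro obj.module_axioms coalg.comul.tensor_module)
  let ?n = "aut M m"
  let ?F = "\<lambda>m0 m1. sweedler T.T (coact m0) (\<lambda>x y.
      x \<boxtimes>\<^bsub>k,M,tensor k C C\<^esub> (y \<boxtimes>\<^bsub>k,C,C\<^esub> aut_inv C m1))"
  let ?G = "\<lambda>m0 m1. aut_inv M m0 \<boxtimes>\<^bsub>k,M,tensor k C C\<^esub> comul m1"
  note closeds = m obj.aut_closed obj.aut_inv_closed coalg.aut_closed coalg.aut_inv_closed
    coalg.comul.closed coalg.comul.pure_closed
  note linears = linear_map_ident coact.sum_linear coact.sum_param bilinear_mapI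
    linear_map_bilinear_left[OF T.pure_bilinear] linear_map_bilinear_right[OF T.pure_bilinear]
    linear_map_bilinear_left[OF coalg.comul.pure_bilinear]
    linear_map_bilinear_right[OF coalg.comul.pure_bilinear]
    linear_map_compose[OF obj.aut_inv_linear] linear_map_compose[OF coalg.aut_inv_linear]
    coalg.comul_linear T.tensor_module
  have "sweedler T.T (coact ?n) (\<lambda>m0 m1. sweedler T.T (coact (aut M m0)) (\<lambda>x y.
      x \<boxtimes>\<^bsub>k,M,tensor k C C\<^esub> (y \<boxtimes>\<^bsub>k,C,C\<^esub> m1)))
    = sweedler T.T (coact ?n) (\<lambda>m0 m1. ?F (aut M m0) (aut C m1))"
    by (intro coact.sum_cong) (simp_all add: closeds coalg.aut_inv_aut)
  also have "\<dots> = sweedler T.T (coact (aut M ?n)) ?F"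
    by (intro coact_aut_sum[symmetric] linears) (simp_all add: closeds)
  also have "\<dots> = sweedler T.T (coact (aut M ?n)) ?G"
    by (intro coact_coassoc) (simp add: closeds)
  also have "\<dots> = sweedler T.T (coact ?n) (\<lambda>m0 m1. ?G (aut M m0) (aut C m1))"
    by (intro coact_aut_sum linears) (simp_all add: closeds)
  also have "\<dots> = sweedler T.T (coact ?n) (\<lambda>m0 m1. m0 \<boxtimes>\<^bsub>k,M,tensor k C C\<^esub> comul (aut C m1))"
    by (intro coact.sum_cong) (simp_all add: closeds obj.aut_inv_aut)
  finally show ?thesis .
qed

end

section \<open>The untwisted datum and its integral\<close>

context doi_hom_hopf_datum
begin

abbreviation "untwisted_structure \<theta> \<equiv>
  doi_structure k A C H (\<lambda>a. acoact A (aut A a)) (\<lambda>c. ccomul C (aut C c)) (untwist k A A (amul A))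
    (aunit A) (ccounit C) (untwist k C H (cact C)) (\<lambda>c d. aut_inv A (\<theta> (c \<boxtimes>\<^bsub>k,C,C\<^esub> d)))
    (aut A) (aut C)"

lemma untwisted_structure:
  assumes \<theta>: "normalized_integral k H A C \<theta>"
  shows "untwisted_structure \<theta>"
proof -
  interpret Am: hom_module k A "amul A" "aunit A" A "amul A"
    by (rule comod_alg.alg.hom_module_self)
  note C = mod_coalg.coalg.aut_closed mod_coalg.coalg.aut_inv_closed
  note A = comod_alg.alg.aut_closed comod_alg.alg.aut_inv_closed
  let ?CC = "tensor k C C" and ?AC = "tensor k A C"
  interpret AC: module_pair k A C
    by (intro module_pair.intro mod_coalg.coalg.module_axioms comod_alg.alg.module_axioms)
  let ?th = "\<lambda>c d. \<theta> (c \<boxtimes>\<^bsub>k,C,C\<^esub> d)" and ?th' = "\<lambda>c d. aut_inv A (\<theta> (c \<boxtimes>\<^bsub>k,C,C\<^esub> d))"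
  have lin: "linear_map k ?CC A \<theta>"
    and equiv: "\<And>t. t \<in> carrier ?CC \<Longrightarrow>
      \<theta> (sweedler ?CC t (\<lambda>c d. aut C c \<boxtimes>\<^bsub>k,C,C\<^esub> aut C d)) = aut A (\<theta> t)"
    and colin: "\<And>c d. c \<in> carrier C \<Longrightarrow> d \<in> carrier C \<Longrightarrow>
      sweedler ?AC (ccomul C c) (\<lambda>c1 c2. ?th (aut_inv C d) c1 \<boxtimes>\<^bsub>k,A,C\<^esub> aut C c2)
      = sweedler ?AC (ccomul C d) (\<lambda>d1 d2.
          sweedler ?AC (acoact A (?th d2 (aut_inv C c))) (\<lambda>t0 t1.
            aut A t0 \<boxtimes>\<^bsub>k,A,C\<^esub> cact C (d1 \<boxtimes>\<^bsub>k,C,H\<^esub> t1)))"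
    and counit: "\<And>c. c \<in> carrier C \<Longrightarrow> \<theta> (ccomul C c) = ccounit C c \<odot>\<^bsub>A\<^esub> aunit A"
    and Alin: "\<And>a c d. a \<in> carrier A \<Longrightarrow> c \<in> carrier C \<Longrightarrow> d \<in> carrier C \<Longrightarrow>
      sweedler A (acoact A a) (\<lambda>a0 a1. sweedler A (acoact A a0) (\<lambda>a00 a01.
        amul A (aut A (aut A a00) \<boxtimes>\<^bsub>k,A,A\<^esub>
          ?th (cact C (aut_inv C d \<boxtimes>\<^bsub>k,C,H\<^esub> a01)) (cact C (aut_inv C c \<boxtimes>\<^bsub>k,C,H\<^esub> aut_inv H a1)))))
        = amul A (?th d c \<boxtimes>\<^bsub>k,A,A\<^esub> a)"
    using \<theta> unfolding normalized_integral_def by blast+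
  have lin': "linear_map k ?CC A (\<lambda>t. aut_inv A (\<theta> t))"
    by (rule linear_map_compose[OF comod_alg.alg.aut_inv_linear lin])
  have bil: "bilinear_map k C C A ?th'" by (rule mod_coalg.coalg.comul.bilinear_map_pure[OF lin'])
  have th: "?th c d \<in> carrier A" if "c \<in> carrier C" "d \<in> carrier C" for c d
    using that by (intro linear_map_closed[OF lin] mod_coalg.coalg.comul.pure_closed)
  have th_aut: "?th (aut C c) (aut C d) = aut A (?th c d)"
    if "c \<in> carrier C" "d \<in> carrier C" for c d
  proof -
    have "sweedler ?CC (c \<boxtimes>\<^bsub>k,C,C\<^esub> d) (\<lambda>c d. aut C c \<boxtimes>\<^bsub>k,C,C\<^esub> aut C d) = aut C c \<boxtimes>\<^bsub>k,C,C\<^esub> aut C d"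
      by (intro mod_coalg.coalg.comul.sweedler_pure mod_coalg.coalg.comul.tensor_module bilinear_mapI that
          linear_map_bilinear_left[OF mod_coalg.coalg.comul.pure_bilinear] linear_map_bilinear_right[OF mod_coalg.coalg.comul.pure_bilinear]
          mod_coalg.coalg.aut_linear C)
    then show ?thesis using equiv[OF mod_coalg.coalg.comul.pure_closed[OF that]] by simp
  qed
  \<comment> \<open>By equivariance the inverse automorphism in front of \<theta> passes to both
    arguments: it cancels the automorphism on one and stays as an inverse on the other. This
    produces the shifted arguments of condition (i).\<close>
  have th_aut': "?th' (aut C c) d = ?th c (aut_inv C d)" "?th' d (aut C c) = ?th (aut_inv C d) c"
    if "c \<in> carrier C" "d \<in> carrier C" for c d
    using th_aut[of c "aut_inv C d"] th_aut[of "aut_inv C d" c] that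
    by (simp_all add: C th mod_coalg.coalg.aut_aut_inv comod_alg.alg.aut_inv_aut)
  have act_aut: "untwist k C H (cact C) c (aut H h) = cact C (aut_inv C c \<boxtimes>\<^bsub>k,C,H\<^esub> h)"
    "untwist k C H (cact C) c h = cact C (aut_inv C c \<boxtimes>\<^bsub>k,C,H\<^esub> aut_inv H h)"
    if "c \<in> carrier C" "h \<in> carrier H" for c h
    using mod_coalg.mod.untwist_aut_aut[of "aut_inv C c" h]
      mod_coalg.mod.untwist_aut_aut[of "aut_inv C c" "aut_inv H h"] that
    by (simp_all add: C hopf.alg.aut_inv_closed hopf.alg.aut_aut_inv mod_coalg.coalg.aut_aut_inv)
  \<comment> \<open>The same shift for products. Both formulas bring out the square of the inverse
    of \<beta>, a linear map that can be taken out of the whole sum in condition (iii).\<close>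
  have mul_inv: "untwist k A A (amul A) (aut_inv A x) y
      = aut_inv A (aut_inv A (amul A (x \<boxtimes>\<^bsub>k,A,A\<^esub> aut A y)))"
    "untwist k A A (amul A) x (aut_inv A y)
      = aut_inv A (aut_inv A (amul A (aut A x \<boxtimes>\<^bsub>k,A,A\<^esub> y)))"
    if "x \<in> carrier A" "y \<in> carrier A" for x y
    using that comod_alg.alg.aut_mul[of "aut_inv A x" y] comod_alg.alg.aut_mul[of x "aut_inv A y"]
      comod_alg.alg.aut_inv_aut[OF Am.act_closed[of "aut_inv A x" y]]
      comod_alg.alg.aut_inv_aut[OF Am.act_closed[of x "aut_inv A y"]]
    by (simp_all add: untwist_def A comod_alg.alg.aut_aut_inv)
  note closeds = C A th mod_coalg.coalg.comul.closed comod_alg.comod.coact.closed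
    bilinear_map_closed[OF bil] Am.act_closed mod_coalg.mod.act_closed
    Am.untwist_closed mod_coalg.mod.untwist_closed
    hopf.alg.aut_closed hopf.alg.aut_inv_closed
    comod_alg.comod.coact.sum_closed mod_coalg.coalg.comul.sum_closed
    AC.pure_closed mod_coalg.coalg.comul.pure_closed
  note modules = AC.tensor_module comod_alg.alg.module_axioms
  interpret rho: tensor_valued k A A H "\<lambda>a. acoact A (aut A a)"
    by (rule comod_alg.comod.untwisted_tensor_valued)
  interpret Delta: tensor_valued k C C C "\<lambda>c. ccomul C (aut C c)"
    by unfold_locales
      (rule linear_map_compose[OF mod_coalg.coalg.comul_linear mod_coalg.coalg.aut_linear])
  note linears = linear_map_ident bilinear_mapI
    linear_map_bilinear_left[OF AC.pure_bilinear] linear_map_bilinear_right[OF AC.pure_bilinear]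
    linear_map_bilinear_left[OF bil] linear_map_bilinear_right[OF bil]
    linear_map_bilinear_left[OF Am.untwist_bilinear]
    linear_map_bilinear_right[OF Am.untwist_bilinear]
    linear_map_bilinear_left[OF mod_coalg.mod.untwist_bilinear]
    linear_map_bilinear_right[OF mod_coalg.mod.untwist_bilinear]
    rho.sum_linear rho.sum_param
  show ?thesis
  proof unfold_locales
    show "bilinear_map k A A A (untwist k A A (amul A))" by (rule Am.untwist_bilinear)
    show "bilinear_map k C H C (untwist k C H (cact C))" by (rule mod_coalg.mod.untwist_bilinear)
    show "bilinear_map k C C A ?th'" by (rule bil)
  next
    fix c assume c: "c \<in> carrier C"
    show "ccounit C c \<in> carrier k"
      using linear_map_closed[OF mod_coalg.coalg.counit_linear c] by (simp add: regular_module_def)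
  next
    fix c assume "c \<in> carrier C"
    then show "aut C c \<in> carrier C" by (rule C)
  next
    fix c d assume "c \<in> carrier C" "d \<in> carrier C"
    then show "?th' (aut C c) (aut C d) = aut A (?th' c d)"
      by (simp add: th_aut th comod_alg.alg.aut_aut_inv comod_alg.alg.aut_inv_aut)
  next
    fix c assume c: "c \<in> carrier C"
    have e: "ccounit C c \<in> carrier k"
      using linear_map_closed[OF mod_coalg.coalg.counit_linear c] by (simp add: regular_module_def)
    have "sweedler A (ccomul C (aut C c)) ?th'
      = aut_inv A (\<theta> (sweedler ?CC (ccomul C (aut C c)) (\<lambda>c d. c \<boxtimes>\<^bsub>k,C,C\<^esub> d)))"
      by (rule mod_coalg.coalg.comul.map_sum[OF _ _ lin', symmetric])
        (simp_all add: c closeds mod_coalg.coalg.comul.tensor_module modules)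
    also have "\<dots> = aut_inv A (ccounit C c \<odot>\<^bsub>A\<^esub> aunit A)"
      using c by (simp add: mod_coalg.coalg.comul.sweedler_self closeds counit
          mod_coalg.coalg.counit_aut)
    also have "\<dots> = ccounit C c \<odot>\<^bsub>A\<^esub> aunit A"
      using linear_map_smult[OF comod_alg.alg.aut_inv_linear e comod_alg.alg.unit_closed]
        comod_alg.alg.aut_inv_aut[OF comod_alg.alg.unit_closed]
      by (simp add: comod_alg.alg.aut_unit)
    finally show "sweedler A (ccomul C (aut C c)) ?th' = ccounit C c \<odot>\<^bsub>A\<^esub> aunit A" .
  next
    fix c d assume c: "c \<in> carrier C" and d: "d \<in> carrier C"
    \<comment> \<open>Expanding \<Delta>(\<gamma>(c)) shifts both factors: \<open>th_aut'\<close>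
      absorbs the first shift, and the second is the \<open>aut C c2\<close> of condition
      (i).\<close>
    have "sweedler ?AC (ccomul C (aut C c)) (\<lambda>c1 c2. ?th' d c1 \<boxtimes>\<^bsub>k,A,C\<^esub> c2)
      = sweedler ?AC (ccomul C c) (\<lambda>c1 c2. ?th (aut_inv C d) c1 \<boxtimes>\<^bsub>k,A,C\<^esub> aut C c2)"
      by (subst mod_coalg.coalg.comul_aut_sum)
        (auto simp: c d closeds th_aut' intro!: mod_coalg.coalg.comul.sum_cong linears modules)
    also have "\<dots> = sweedler ?AC (ccomul C d) (\<lambda>d1 d2.
        sweedler ?AC (acoact A (?th d2 (aut_inv C c))) (\<lambda>t0 t1.
          aut A t0 \<boxtimes>\<^bsub>k,A,C\<^esub> untwist k C H (cact C) (aut C d1) (aut H t1)))"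
      unfolding colin[OF c d]
      by (intro mod_coalg.coalg.comul.sum_cong comod_alg.comod.coact.sum_cong)
        (simp_all add: c d closeds mod_coalg.mod.untwist_aut_aut)
    \<comment> \<open>The shifts of \<open>t0\<close> and \<open>t1\<close> are gathered into one
      \<beta> under the coaction of A; those of \<open>d1\<close> and \<open>d2\<close> are gathered
      into \<Delta>(\<gamma>(d)) afterwards.\<close>
    also have "\<dots> = sweedler ?AC (ccomul C d) (\<lambda>d1 d2.
        sweedler ?AC (acoact A (aut A (?th' (aut C d2) c))) (\<lambda>t0 t1.
          t0 \<boxtimes>\<^bsub>k,A,C\<^esub> untwist k C H (cact C) (aut C d1) t1))"
      by (intro mod_coalg.coalg.comul.sum_cong d, subst comod_alg.comod.coact_aut_sum)
        (auto simp: c closeds th_aut' intro!: linears modules)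
    also have "\<dots> = sweedler ?AC (ccomul C (aut C d)) (\<lambda>d1 d2.
        sweedler ?AC (acoact A (aut A (?th' d2 c))) (\<lambda>t0 t1.
          t0 \<boxtimes>\<^bsub>k,A,C\<^esub> untwist k C H (cact C) d1 t1))"
      by (rule mod_coalg.coalg.comul_aut_sum[symmetric])
        (auto simp: c d closeds intro!: linears modules)
    finally show "sweedler ?AC (ccomul C (aut C c)) (\<lambda>c1 c2. ?th' d c1 \<boxtimes>\<^bsub>k,A,C\<^esub> c2)
      = sweedler ?AC (ccomul C (aut C d)) (\<lambda>d1 d2.
        sweedler ?AC (acoact A (aut A (?th' d2 c))) (\<lambda>t0 t1.
          t0 \<boxtimes>\<^bsub>k,A,C\<^esub> untwist k C H (cact C) d1 t1))" .
  next
    fix a c d assume a: "a \<in> carrier A" and c: "c \<in> carrier C" and d: "d \<in> carrier C"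
    let ?m = "untwist k A A (amul A)" and ?ac = "untwist k C H (cact C)"
    let ?G = "\<lambda>a1 x y. amul A (aut A (aut A x) \<boxtimes>\<^bsub>k,A,A\<^esub>
      ?th (cact C (aut_inv C d \<boxtimes>\<^bsub>k,C,H\<^esub> y)) (cact C (aut_inv C c \<boxtimes>\<^bsub>k,C,H\<^esub> aut_inv H a1)))"
    let ?L = "\<lambda>x. aut_inv A (aut_inv A x)"
    have L: "linear_map k A A ?L"
      by (rule linear_map_compose[OF comod_alg.alg.aut_inv_linear comod_alg.alg.aut_inv_linear])
    \<comment> \<open>Condition (iii) is used at \<beta>(a), the element on which the untwisted
      coaction evaluates \<open>acoact\<close>. The inner automorphism is moved onto
      \<open>x\<close> and \<open>y\<close>: it accounts for one of the two on \<open>x\<close> in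
      \<open>?G\<close>, and on \<open>y\<close> it cancels an inverse.\<close>
    have "sweedler A (acoact A (aut A a)) (\<lambda>a0 a1. sweedler A (acoact A (aut A a0)) (\<lambda>x y.
        ?m x (?th' (?ac d y) (?ac c a1))))
      = sweedler A (acoact A (aut A a)) (\<lambda>a0 a1. sweedler A (acoact A a0) (\<lambda>x y.
        ?m (aut A x) (?th' (?ac d (aut H y)) (?ac c a1))))"
      by (intro comod_alg.comod.coact.sum_cong comod_alg.comod.coact_aut_sum linears modules)
        (simp_all add: a c d closeds)
    also have "\<dots> = sweedler A (acoact A (aut A a)) (\<lambda>a0 a1. sweedler A (acoact A a0) (\<lambda>x y.
        ?L (?G a1 x y)))"
      by (intro comod_alg.comod.coact.sum_cong)
        (simp_all add: a c d closeds act_aut mul_inv hopf.alg.aut_inv_aut)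
    also have "\<dots> = sweedler A (acoact A (aut A a)) (\<lambda>a0 a1. ?L (sweedler A (acoact A a0) (?G a1)))"
      by (intro comod_alg.comod.coact.sum_cong comod_alg.comod.coact.map_sum[symmetric] L modules)
        (simp_all add: a c d closeds)
    also have "\<dots> = ?L (sweedler A (acoact A (aut A a)) (\<lambda>a0 a1. sweedler A (acoact A a0) (?G a1)))"
      by (intro comod_alg.comod.coact.map_sum[symmetric] L modules)
        (simp_all add: a c d closeds modules)
    also have "\<dots> = ?m (?th' d c) a"
      by (simp add: Alin a c d closeds mul_inv)
    finally show "sweedler A (acoact A (aut A a)) (\<lambda>a0 a1. sweedler A (acoact A (aut A a0)) (\<lambda>x y.
        ?m x (?th' (?ac d y) (?ac c a1)))) = ?m (?th' d c) a" .
  qed (rule comod_alg.alg.unit_closed)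
qed

end

section \<open>Untwisted Doi Hom-Hopf modules\<close>

context doi_hom_hopf_module
begin

abbreviation "untwisted_comodule \<theta> \<equiv>
  doi_comodule k A C H (\<lambda>a. acoact A (aut A a)) (\<lambda>c. ccomul C (aut C c)) (untwist k A A (amul A))
    (aunit A) (ccounit C) (untwist k C H (cact C)) (\<lambda>c d. aut_inv A (\<theta> (c \<boxtimes>\<^bsub>k,C,C\<^esub> d)))
    (aut A) (aut C) M (\<lambda>m. mcoact M (aut M m)) (untwist k M A (mact M)) (aut M)"

lemma untwisted_comodule:
  assumes "normalized_integral k H A C \<theta>"
  shows "untwisted_comodule \<theta>"
proof -
  interpret S: doi_structure k A C H "\<lambda>a. acoact A (aut A a)" "\<lambda>c. ccomul C (aut C c)"
    "untwist k A A (amul A)" "aunit A" "ccounit C" "untwist k C H (cact C)"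
    "\<lambda>c d. aut_inv A (\<theta> (c \<boxtimes>\<^bsub>k,C,C\<^esub> d))" "aut A" "aut C"
    by (rule datum.untwisted_structure[OF assms])
  interpret rho: tensor_valued k M M C "\<lambda>m. mcoact M (aut M m)"
    by (rule comod.untwisted_tensor_valued)
  let ?T = "tensor k M C"
  note act = datum.mod_coalg.mod.untwist_bilinear mod.untwist_bilinear
  note closeds = mod.obj.aut_closed mod.act_closed mod.untwist_closed datum.comod_alg.alg.aut_closed
    datum.mod_coalg.coalg.aut_closed datum.mod_coalg.mod.untwist_closed datum.hopf.alg.aut_closed
    datum.comod_alg.comod.coact.closed datum.comod_alg.comod.coact.sum_closed
    comod.coact.closed comod.coact.pure_closed
  note linears = linear_map_ident bilinear_mapI
    linear_map_bilinear_left[OF comod.coact.pure_bilinear]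
    linear_map_bilinear_right[OF comod.coact.pure_bilinear]
    linear_map_bilinear_left[OF act(1)] linear_map_bilinear_right[OF act(1)]
    linear_map_bilinear_left[OF act(2)] linear_map_bilinear_right[OF act(2)]
    datum.comod_alg.comod.coact.sum_linear datum.comod_alg.comod.coact.sum_param
    comod.coact.tensor_module
  show ?thesis
  proof unfold_locales
    fix m a assume m: "m \<in> carrier M" and a: "a \<in> carrier A"
    let ?m = "untwist k M A (mact M)" and ?c = "untwist k C H (cact C)"
    \<comment> \<open>The automorphism in the untwisted coaction cancels the inverse in the
      untwisted action, so the compatibility axiom applies to the Hom-product of \<open>m\<close>
      and \<open>a\<close> itself. The shifts of the factors are then gathered into
      \<open>aut A a\<close> and \<open>aut M m\<close>.\<close>
    have "mcoact M (aut M (?m m a)) = sweedler ?T (mcoact M m) (\<lambda>m0 m1.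
        sweedler ?T (acoact A a) (\<lambda>a0 a1.
          ?m (aut M m0) (aut A a0) \<boxtimes>\<^bsub>k,M,C\<^esub> ?c (aut C m1) (aut H a1)))"
      unfolding mod.aut_untwist[OF m a] coact_act[OF m a]
      by (intro comod.coact.sum_cong datum.comod_alg.comod.coact.sum_cong m a)
        (simp add: mod.untwist_aut_aut datum.mod_coalg.mod.untwist_aut_aut)
    also have "\<dots> = sweedler ?T (mcoact M m) (\<lambda>m0 m1.
        sweedler ?T (acoact A (aut A a)) (\<lambda>a0 a1.
          ?m (aut M m0) a0 \<boxtimes>\<^bsub>k,M,C\<^esub> ?c (aut C m1) a1))"
      by (intro comod.coact.sum_cong datum.comod_alg.comod.coact_aut_sum[symmetric] m a linears)
        (simp_all add: closeds)
    also have "\<dots> = sweedler ?T (mcoact M (aut M m)) (\<lambda>m0 m1.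
        sweedler ?T (acoact A (aut A a)) (\<lambda>a0 a1. ?m m0 a0 \<boxtimes>\<^bsub>k,M,C\<^esub> ?c m1 a1))"
      by (intro comod.coact_aut_sum[symmetric] m a linears) (simp_all add: closeds a)
    finally show "mcoact M (aut M (?m m a)) = sweedler ?T (mcoact M (aut M m)) (\<lambda>m0 m1.
        sweedler ?T (acoact A (aut A a)) (\<lambda>a0 a1. ?m m0 a0 \<boxtimes>\<^bsub>k,M,C\<^esub> ?c m1 a1))" .
  next
    fix m a assume "m \<in> carrier M" "a \<in> carrier A"
    then show "untwist k M A (mact M) (aut M m) (aut A a) = aut M (untwist k M A (mact M) m a)"
      by (simp add: mod.untwist_aut_aut mod.aut_untwist)
  next
    fix m assume m: "m \<in> carrier M"
    show "sweedler M (mcoact M (aut M m)) (\<lambda>m0 m1. ccounit C m1 \<odot>\<^bsub>M\<^esub> m0) = m"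
      using m by (simp add: comod.coact_counit closeds mod.obj.aut_inv_aut)
  qed (simp_all add: act mod.untwist_untwist mod.untwist_unit mod.obj.aut_linear
      comod.untwisted_coassoc, simp add: comod.coact_aut closeds)
qed

end

section \<open>Return to Hom-modules\<close>

lemma hom_object_hom_aut_inv:
  assumes "hom_object k M" "hom_object k N" "hom_object_hom k M N f" "x \<in> carrier M"
  shows "f (aut_inv M x) = aut_inv N (f x)"
proof -
  interpret M: hom_object k M by fact
  interpret N: hom_object k N by fact
  have f: "linear_map k M N f" "\<And>m. m \<in> carrier M \<Longrightarrow> aut N (f m) = f (aut M m)"
    using assms(3) by (auto simp: hom_object_hom_def)
  have "f (aut_inv M x) = aut_inv N (aut N (f (aut_inv M x)))"
    using assms(4) by (simp add: N.aut_inv_aut linear_map_closed[OF f(1)] M.aut_inv_closed)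
  then show ?thesis using assms(4) by (simp add: f(2) M.aut_inv_closed M.aut_aut_inv)
qed

text \<open>The averaged map depends on \<open>g\<close> alone, so \<open>f\<close> is quantified
  after it, and one construction serves left and right inverses.\<close>

lemma exists_averaged_hom:
  assumes "doi_hom_hopf_module k H A C M" "doi_hom_hopf_module k H A C N"
    and \<theta>: "normalized_integral k H A C \<theta>" and g: "hom_module_hom k A N M g"
  obtains h where "doi_module_hom k A C N M h"
    "\<And>f. doi_module_hom k A C M N f \<Longrightarrow> \<forall>x\<in>carrier M. g (f x) = x \<Longrightarrow>
      \<forall>x\<in>carrier M. h (f x) = x"
    "\<And>f. doi_module_hom k A C M N f \<Longrightarrow> \<forall>y\<in>carrier N. f (g y) = y \<Longrightarrow>
      \<forall>y\<in>carrier N. f (h y) = y"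
proof -
  interpret M: doi_hom_hopf_module k H A C M by fact
  interpret N: doi_hom_hopf_module k H A C N by fact
  have g_hom: "hom_object_hom k N M g"
    and g_linear: "linear_map k N M g"
    and g_aut: "\<And>n. n \<in> carrier N \<Longrightarrow> aut M (g n) = g (aut N n)"
    and g_act: "\<And>n a. n \<in> carrier N \<Longrightarrow> a \<in> carrier A \<Longrightarrow>
      g (mact N (n \<boxtimes>\<^bsub>k,N,A\<^esub> a)) = mact M (g n \<boxtimes>\<^bsub>k,M,A\<^esub> a)"
    using g by (auto simp: hom_module_hom_def hom_object_hom_def)
  have averaging: "doi_averaging k A C H (\<lambda>a. acoact A (aut A a)) (\<lambda>c. ccomul C (aut C c))
      (untwist k A A (amul A)) (aunit A) (ccounit C) (untwist k C H (cact C))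
      (\<lambda>c d. aut_inv A (\<theta> (c \<boxtimes>\<^bsub>k,C,C\<^esub> d))) (aut A) (aut C)
      N (\<lambda>n. mcoact N (aut N n)) (untwist k N A (mact N)) (aut N)
      M (\<lambda>m. mcoact M (aut M m)) (untwist k M A (mact M)) (aut M) g"
  proof (intro doi_averaging.intro doi_averaging_axioms.intro
      N.untwisted_comodule[OF \<theta>] M.untwisted_comodule[OF \<theta>] g_linear)
    fix n a assume "n \<in> carrier N" "a \<in> carrier A"
    then show "g (untwist k N A (mact N) n a) = untwist k M A (mact M) (g n) a"
      \<comment> \<open>The untwisted action contains an inverse automorphism, with which
        \<open>g\<close> commutes because it commutes with the automorphism.\<close>
      unfolding untwist_def
      using hom_object_hom_aut_inv[OF N.mod.obj.hom_object_axioms M.mod.obj.hom_object_axioms g_hom]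
      by (simp add: N.mod.act_closed g_act)
  qed (simp add: g_aut)
  interpret av: doi_averaging k A C H "\<lambda>a. acoact A (aut A a)" "\<lambda>c. ccomul C (aut C c)"
    "untwist k A A (amul A)" "aunit A" "ccounit C" "untwist k C H (cact C)"
    "\<lambda>c d. aut_inv A (\<theta> (c \<boxtimes>\<^bsub>k,C,C\<^esub> d))" "aut A" "aut C"
    N "\<lambda>n. mcoact N (aut N n)" "untwist k N A (mact N)" "aut N"
    M "\<lambda>m. mcoact M (aut M m)" "untwist k M A (mact M)" "aut M" g
    by (rule averaging)
  let ?h = av.averaged
  note closed = linear_map_closed[OF av.averaged_linear]
  have h: "doi_module_hom k A C N M ?h"
    unfolding doi_module_hom_def hom_module_hom_def hom_object_hom_def
  proof (intro conjI ballI av.averaged_linear)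
    fix n assume n: "n \<in> carrier N"
    show "aut M (?h n) = ?h (aut N n)" using n by (simp add: av.averaged_equivariant)
    \<comment> \<open>The Hom-action is the automorphism applied to the untwisted action, so
      linearity is recovered from equivariance of the average.\<close>
    show "?h (mact N (n \<boxtimes>\<^bsub>k,N,A\<^esub> a)) = mact M (?h n \<boxtimes>\<^bsub>k,M,A\<^esub> a)" if "a \<in> carrier A" for a
      using av.averaged_equivariant[OF N.mod.untwist_closed[OF n that]]
      by (simp add: n that closed av.averaged_act N.mod.aut_untwist M.mod.aut_untwist)
    \<comment> \<open>The untwisted coaction at a point is the Hom-coaction at its image under the
      automorphism, so the identity is taken at the preimage \<open>aut_inv N n\<close>.\<close>
    show "mcoact M (?h n) = sweedler (tensor k M C) (mcoact N n) (\<lambda>m0 m1. ?h m0 \<boxtimes>\<^bsub>k,M,C\<^esub> m1)"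
      using av.rho_averaged[of "aut_inv N n"] av.averaged_equivariant[of "aut_inv N n"] n
      by (simp add: N.mod.obj.aut_inv_closed N.mod.obj.aut_aut_inv)
  qed
  have f: "linear_map k M N f"
    "\<And>x a. x \<in> carrier M \<Longrightarrow> a \<in> carrier A \<Longrightarrow>
      f (untwist k M A (mact M) x a) = untwist k N A (mact N) (f x) a"
    "\<And>x. x \<in> carrier M \<Longrightarrow> mcoact N (aut N (f x))
      = sweedler (tensor k N C) (mcoact M (aut M x)) (\<lambda>m0 m1. f m0 \<boxtimes>\<^bsub>k,N,C\<^esub> m1)"
    if "doi_module_hom k A C M N f" for f
  proof -
    have f_hom: "hom_object_hom k M N f"
      and f_act: "\<And>x a. x \<in> carrier M \<Longrightarrow> a \<in> carrier A \<Longrightarrow>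
        f (mact M (x \<boxtimes>\<^bsub>k,M,A\<^esub> a)) = mact N (f x \<boxtimes>\<^bsub>k,N,A\<^esub> a)"
      and f_coact: "\<And>x. x \<in> carrier M \<Longrightarrow>
        mcoact N (f x) = sweedler (tensor k N C) (mcoact M x) (\<lambda>m0 m1. f m0 \<boxtimes>\<^bsub>k,N,C\<^esub> m1)"
      using that by (auto simp: doi_module_hom_def hom_module_hom_def)
    show "linear_map k M N f" using f_hom by (simp add: hom_object_hom_def)
    fix x assume x: "x \<in> carrier M"
    show "mcoact N (aut N (f x))
      = sweedler (tensor k N C) (mcoact M (aut M x)) (\<lambda>m0 m1. f m0 \<boxtimes>\<^bsub>k,N,C\<^esub> m1)"
      using f_hom x f_coact[OF M.mod.obj.aut_closed[OF x]] by (simp add: hom_object_hom_def)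
    show "f (untwist k M A (mact M) x a) = untwist k N A (mact N) (f x) a" if "a \<in> carrier A" for a
      unfolding untwist_def
      using hom_object_hom_aut_inv[OF M.mod.obj.hom_object_axioms N.mod.obj.hom_object_axioms f_hom]
      by (simp add: M.mod.act_closed f_act x that)
  qed
  show ?thesis
    using h
  proof (rule that)
    fix f assume *: "doi_module_hom k A C M N f" "\<forall>x\<in>carrier M. g (f x) = x"
    show "\<forall>x\<in>carrier M. ?h (f x) = x"
      using *(2) av.averaged_retraction[OF f(1)[OF *(1)] _ f(3)[OF *(1)]] by blast
  next
    fix f assume *: "doi_module_hom k A C M N f" "\<forall>y\<in>carrier N. f (g y) = y"
    show "\<forall>y\<in>carrier N. f (?h y) = y"
      using *(2) av.averaged_section[OF f(1)[OF *(1)] _ f(2)[OF *(1)] f(3)[OF *(1)]] by blast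
  qed
qed

theorem corollary5p1:
  fixes k :: "'k ring"
    and H :: "('k, 'h) hom_bialgebra"
    and A :: "('k, 'h, 'a) hom_comodule_algebra"
    and C :: "('k, 'h, 'c) hom_module_coalgebra"
    and M N :: "('k, 'm, 'a, 'c) doi_module"
    and f :: "'m \<Rightarrow> 'm"
  assumes "doi_hom_hopf_datum k H A C"
    and "doi_hom_hopf_module k H A C M"
    and "doi_hom_hopf_module k H A C N"
    and "\<exists>\<theta>. normalized_integral k H A C \<theta>"
  shows "(doi_mono k H A C M N f \<and> has_left_inverse (hom_module_hom k A) M N f
            \<longrightarrow> has_left_inverse (doi_module_hom k A C) M N f) \<and>
         (doi_epi k H A C M N f \<and> has_right_inverse (hom_module_hom k A) M N f
            \<longrightarrow> has_right_inverse (doi_module_hom k A C) M N f)"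
proof (intro conjI impI; elim conjE)
  obtain \<theta> where \<theta>: "normalized_integral k H A C \<theta>" using assms(4) by blast
  note averaged = exists_averaged_hom[OF assms(2,3) \<theta>]
  {
    assume "doi_mono k H A C M N f" "has_left_inverse (hom_module_hom k A) M N f"
    then have f: "doi_module_hom k A C M N f"
      and "\<exists>g. hom_module_hom k A N M g \<and> (\<forall>x\<in>carrier M. g (f x) = x)"
      by (simp_all add: doi_mono_def has_left_inverse_def)
    then obtain g where g: "hom_module_hom k A N M g" "\<forall>x\<in>carrier M. g (f x) = x" by blast
    show "has_left_inverse (doi_module_hom k A C) M N f"
      by (rule averaged[OF g(1)]) (use f g(2) in \<open>auto simp: has_left_inverse_def\<close>)
  next
    assume "doi_epi k H A C M N f" "has_right_inverse (hom_module_hom k A) M N f"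
    then have f: "doi_module_hom k A C M N f"
      and "\<exists>g. hom_module_hom k A N M g \<and> (\<forall>y\<in>carrier N. f (g y) = y)"
      by (simp_all add: doi_epi_def has_right_inverse_def)
    then obtain g where g: "hom_module_hom k A N M g" "\<forall>y\<in>carrier N. f (g y) = y" by blast
    show "has_right_inverse (doi_module_hom k A C) M N f"
      by (rule averaged[OF g(1)]) (use f g(2) in \<open>auto simp: has_right_inverse_def\<close>)
  }
qed

end
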